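(* Let $d \ge 1$. Let $Q$ be a symmetric, translation-invariant, heavy-tailed transition kernel on $\mathbb{Z}^d$ with exponent $\alpha > d$. Consider the frog model on $\mathbb{Z}^d$ with kernel $Q$ (without planted particle), particle density $\lambda>0$ and particle lifespan $\ell\in\{1,2,\dots\}$. For every $\epsilon \in (0, 1)$ there exists a positive constant $c = c(Q, \lambda, \ell, \epsilon)$ such that $$\mathbb{P}\left( \text{for all } L>0:\ \mathcal{A}(cL) \subseteq B(L)\ \text{ and }\ \frac{|\mathcal{A}(cL)|}{L^d} < \epsilon \right) \ge 1 - \epsilon,$$ where $B(L) = [-L, L]^d \cap \mathbb{Z}^d$ and $\mathcal{A}(t)$ is the set of vertices activated by time $t$.
   Context: **Kernels.** $|\cdot|$ applied to a point is the $\ell_\infty$-norm; applied to a set it is the cardinality. A transition kernel $Q$ on $\mathbb{Z}^d$ (nonnegative, rows summing to 1) is symmetric if $Q(x,y)=Q(y,x)$, translation-invariant if $Q(x,y)=Q(0,y-x)$, and heavy-tailed with exponent $\alpha$ if there is $K>0$ with $K^{-1}|x-y|^{-(d+\alpha)}\le Q(x,y)\le K|x-y|^{-(d+\alpha)}$ for all $x\neq y$. $o=0$ is the origin. **Frog model.** Each vertex $v\in\mathbb{Z}^d$ carries an independent Poisson($\lambda$) number of particles. Every particle has an independent infinite discrete-time random walk trajectory with kernel $Q$ started at its initial vertex. At time 0 the particles at $o$ are active and all others are inactive; an active particle walks along its trajectory for $\ell$ steps and is then removed, and inactive particles at a vertex become active as soon as an active particle visits that vertex. Formally, let $T(v,u)$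 be the smallest $k\in\{0,\dots,\ell\}$ such that some particle started at $v$ is at $u$ after $k$ steps ($\infty$ if none). The activation time is $\mathrm{AT}(o,u)=\inf\sum_{i=1}^m T(v_{i-1},v_i)$, the infimum being over $m\ge0$ and sequences $o=v_0,v_1,\dots,v_m=u$ with all $T(v_{i-1},v_i)<\infty$ ($\inf\emptyset=\infty$; in particular $\mathrm{AT}(o,o)=0$). Set $\mathcal{A}(t)=\{u:\mathrm{AT}(o,u)\le t\}$. $\mathbb{P}$ is the law of this model.
   Formalization: The bound |A(cL)|/L^d < ε is required only for L with L^d > 1/ε; for smaller L it always fails because the origin belongs to A(cL). The inclusion A(cL) ⊆ B(L) is kept for all L > 0. *)

theory Defs
  imports "HOL-Probability.Probability"
begin

section \<open>Transition kernels on the integer lattice\<close>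

text \<open>
  The lattice is the type \<open>int ^ 'd\<close>, of dimension \<open>CARD('d) \<ge> 1\<close>. A transition kernel is a
  function \<open>Q\<close> into \<open>pmf\<close>: \<open>pmf (Q x) y\<close> is \<open>Q(x, y)\<close>, nonnegative and with rows summing to 1.
\<close>

definition sup_norm :: "int ^ 'd \<Rightarrow> int" where
  "sup_norm x = Max (range (\<lambda>i. \<bar>x $ i\<bar>))"

definition symmetric_kernel :: "(int ^ 'd \<Rightarrow> (int ^ 'd) pmf) \<Rightarrow> bool" where
  "symmetric_kernel Q \<longleftrightarrow> (\<forall>x y. pmf (Q x) y = pmf (Q y) x)"

definition translation_invariant :: "(int ^ 'd \<Rightarrow> (int ^ 'd) pmf) \<Rightarrow> bool" where
  "translation_invariant Q \<longleftrightarrow> (\<forall>x y. pmf (Q x) y = pmf (Q 0) (y - x))"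

definition heavy_tailed :: "real \<Rightarrow> (int ^ 'd \<Rightarrow> (int ^ 'd) pmf) \<Rightarrow> bool" where
  "heavy_tailed \<alpha> Q \<longleftrightarrow> (\<exists>K>0. \<forall>x y. x \<noteq> y \<longrightarrow>
     inverse K * real_of_int (sup_norm (x - y)) powr - (real CARD('d) + \<alpha>) \<le> pmf (Q x) y \<and>
     pmf (Q x) y \<le> K * real_of_int (sup_norm (x - y)) powr - (real CARD('d) + \<alpha>))"

definition lattice_box :: "real \<Rightarrow> (int ^ 'd) set" where
  "lattice_box L = {x. \<forall>i. real_of_int (x $ i) \<in> {-L..L}}"

section \<open>The law of a random walk trajectory\<close>

text \<open>
  Conditional law of position \<open>n\<close> given the positions \<open>p 0, \<dots>, p (n - 1)\<close>. The Ionescu-Tulcea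
  construction turns it into the law of the Markov chain with kernel \<open>Q\<close> started at \<open>v\<close>, a measure
  on \<open>nat \<Rightarrow> 'v\<close>; lemma \<open>emeasure_walk_cylinder\<close> gives its finite-dimensional distributions.
\<close>

definition walk_step :: "('v \<Rightarrow> 'v pmf) \<Rightarrow> 'v \<Rightarrow> nat \<Rightarrow> (nat \<Rightarrow> 'v) \<Rightarrow> 'v measure" where
  "walk_step Q v n p = (case n of 0 \<Rightarrow> measure_pmf (return_pmf v) | Suc m \<Rightarrow> measure_pmf (Q (p m)))"

definition walk_law :: "('v \<Rightarrow> 'v pmf) \<Rightarrow> 'v \<Rightarrow> (nat \<Rightarrow> 'v) measure" where
  "walk_law Q v = projective_family.lim UNIV
     (Ionescu_Tulcea.CI (walk_step Q v) (\<lambda>_. count_space UNIV)) (\<lambda>_. count_space UNIV)"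

lemma Ionescu_Tulcea_walk: "Ionescu_Tulcea (walk_step Q v) (\<lambda>_. count_space UNIV)"
proof (rule Ionescu_Tulcea.intro)
  have pmf: "measure_pmf p \<in> space (subprob_algebra (count_space UNIV))" for p :: "'a pmf"
    by (rule measure_pmf_in_subprob_algebra)
  show "walk_step Q v i \<in> PiM {0..<i} (\<lambda>_. count_space UNIV) \<rightarrow>\<^sub>M subprob_algebra (count_space UNIV)" for i
  proof (cases i)
    case 0
    have "walk_step Q v 0 = (\<lambda>_. measure_pmf (return_pmf v))"
      by (simp add: walk_step_def fun_eq_iff)
    then show ?thesis unfolding 0 using pmf by (simp only: measurable_const)
  next
    case (Suc m)
    have eq: "walk_step Q v (Suc m) = (\<lambda>p. measure_pmf (Q (p m)))"
      by (simp add: walk_step_def fun_eq_iff)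
    have "(\<lambda>p. p m) \<in> PiM {0..<i} (\<lambda>_. count_space UNIV) \<rightarrow>\<^sub>M count_space (UNIV :: 'a set)"
      using Suc by (intro measurable_component_singleton) auto
    then show ?thesis unfolding Suc eq
      by (rule measurable_compose) (use pmf in \<open>simp only: measurable_count_space_eq1 Pi_I\<close>)
  qed
  show "prob_space (walk_step Q v i x)" if "x \<in> space (PiM {0..<i} (\<lambda>_. count_space UNIV))" for i x
    by (cases i) (simp_all add: walk_step_def measure_pmf.prob_space_axioms)
qed

lemma sets_walk_law: "sets (walk_law Q v) = sets (PiM UNIV (\<lambda>_. count_space UNIV))"
proof -
  interpret IT: Ionescu_Tulcea "walk_step Q v" "\<lambda>_. count_space UNIV" by (rule Ionescu_Tulcea_walk)
  show ?thesis unfolding walk_law_def by (rule IT.PF.sets_lim)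
qed

lemma space_walk_law: "space (walk_law Q v) = UNIV"
  using sets_eq_imp_space_eq[OF sets_walk_law, of Q v] by (auto simp: space_PiM)

lemma emeasure_walk_cylinder:
  "emeasure (walk_law Q v) {X. \<forall>i\<le>n. X i = x i} =
     (if x 0 = v then ennreal (\<Prod>i<n. pmf (Q (x i)) (x (Suc i))) else 0)"
proof -
  interpret IT: Ionescu_Tulcea "walk_step Q v" "\<lambda>_. count_space UNIV" by (rule Ionescu_Tulcea_walk)
  let ?M = "\<lambda>_::nat. count_space (UNIV :: 'a set)"
  define A where "A n = ({restrict x {0..<n}} :: (nat \<Rightarrow> 'a) set)" for n
  have A_eq: "A n = PiE {0..<n} (\<lambda>i. {x i})" for n
    by (auto simp: A_def PiE_iff extensional_def fun_eq_iff)
  have A_sets [measurable]: "A n \<in> sets (PiM {0..<n} ?M)" for n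
    unfolding A_eq by (intro sets_PiM_I_finite) auto
  have u: "(\<lambda>_. undefined) \<in> space (PiM {0..<0} ?M)" by (simp add: space_PiM)
  have step: "emeasure (IT.C 0 (Suc n) (\<lambda>_. undefined)) (A (Suc n)) =
      emeasure (IT.C 0 n (\<lambda>_. undefined)) (A n) * emeasure (walk_step Q v n (restrict x {0..<n})) {x n}" for n
  proof -
    have "emeasure (IT.C 0 (Suc n) (\<lambda>_. undefined)) (A (Suc n)) =
        (\<integral>\<^sup>+\<omega>. emeasure (IT.eP n \<omega>) (A (Suc n)) \<partial>IT.C 0 n (\<lambda>_. undefined))"
      using IT.measurable_eP[of n]
      by (simp, subst emeasure_bind[where N = "PiM {0..<Suc n} ?M"])
         (auto simp: IT.space_C[OF u] measurable_cong_sets[OF IT.sets_C[OF u]] space_PiM)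
    also have "\<dots> = (\<integral>\<^sup>+\<omega>. emeasure (walk_step Q v n (restrict x {0..<n})) {x n} * indicator (A n) \<omega> \<partial>IT.C 0 n (\<lambda>_. undefined))"
    proof (rule nn_integral_cong)
      fix \<omega> assume "\<omega> \<in> space (IT.C 0 n (\<lambda>_. undefined))"
      then have w: "\<omega> \<in> space (PiM {0..<n} ?M)" by (simp add: IT.space_C[OF u])
      then have ext: "\<omega> \<in> extensional {0..<n}" by (auto simp: space_PiM PiE_iff)
      have "fun_upd \<omega> n -` A (Suc n) = (if \<omega> \<in> A n then {x n} else {})"
      proof -
        have "fun_upd \<omega> n y = restrict x {0..<Suc n} \<longleftrightarrow> \<omega> = restrict x {0..<n} \<and> y = x n" for y
        proof
          assume h: "fun_upd \<omega> n y = restrict x {0..<Suc n}"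
          have "\<omega> k = restrict x {0..<n} k" for k
            using fun_cong[OF h, of k] ext by (cases "k < n") (auto simp: extensional_def)
          with fun_cong[OF h, of n] show "\<omega> = restrict x {0..<n} \<and> y = x n" by auto
        qed (auto simp: fun_eq_iff)
        then show ?thesis by (auto simp: A_def)
      qed
      then show "emeasure (IT.eP n \<omega>) (A (Suc n)) = emeasure (walk_step Q v n (restrict x {0..<n})) {x n} * indicator (A n) \<omega>"
        by (subst IT.emeasure_eP[OF w A_sets]) (auto simp: A_def)
    qed
    also have "\<dots> = emeasure (walk_step Q v n (restrict x {0..<n})) {x n} * emeasure (IT.C 0 n (\<lambda>_. undefined)) (A n)"
      by (subst nn_integral_cmult_indicator) (auto simp: IT.sets_C[OF u])
    finally show ?thesis by (simp add: mult.commute)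
  qed
  have C: "emeasure (IT.C 0 (Suc n) (\<lambda>_. undefined)) (A (Suc n)) =
     (if x 0 = v then ennreal (\<Prod>i<n. pmf (Q (x i)) (x (Suc i))) else 0)" for n
  proof (induction n)
    case 0
    have "emeasure (IT.C 0 0 (\<lambda>_. undefined)) (A 0) = 1"
      using A_sets[of 0] by (auto simp: A_def restrict_def)
    then show ?case unfolding step by (simp add: walk_step_def indicator_def)
  next
    case (Suc n)
    show ?case unfolding step[of "Suc n"] Suc.IH
      by (simp add: walk_step_def emeasure_pmf_single ennreal_mult prod_nonneg)
  qed
  have "{X. \<forall>i\<le>n. X i = x i} = prod_emb UNIV ?M {0..<Suc n} (A (Suc n))"
    unfolding A_eq by (auto simp: prod_emb_def PiE_iff le_simps)
  then have "emeasure (walk_law Q v) {X. \<forall>i\<le>n. X i = x i} = emeasure (IT.CI {0..<Suc n}) (A (Suc n))"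
    unfolding walk_law_def using IT.lim[OF _ A_sets[of "Suc n"]] by simp
  also have "\<dots> = emeasure (IT.C 0 (Suc n) (\<lambda>_. undefined)) (A (Suc n))"
    using IT.emeasure_CI[OF order_refl A_sets[of "Suc n"]]
    by (simp add: prod_emb_id sets.sets_into_space[OF A_sets, unfolded space_PiM] A_eq del: IT.C.simps)
  finally show ?thesis unfolding C .
qed

lemma prob_space_walk_law: "prob_space (walk_law Q v)"
proof -
  interpret IT: Ionescu_Tulcea "walk_step Q v" "\<lambda>_. count_space UNIV" by (rule Ionescu_Tulcea_walk)
  have emb: "prod_emb UNIV (\<lambda>_. count_space UNIV) {} {\<lambda>_. undefined} = (UNIV :: (nat \<Rightarrow> 'a) set)"
    by (auto simp: prod_emb_def restrict_def)
  have "emeasure (walk_law Q v) UNIV = emeasure (IT.CI {}) {\<lambda>_. undefined}"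
    unfolding walk_law_def using IT.lim[of "{}" "{\<lambda>_. undefined}"] unfolding emb
    by (simp add: sets_PiM_empty)
  also have "\<dots> = 1"
    using prob_space.emeasure_space_1[OF IT.PF.prob_space_P[of "{}"]]
    by (simp add: IT.PF.space_P space_PiM)
  finally show ?thesis by (intro prob_spaceI) (simp add: space_walk_law)
qed

section \<open>The frog model\<close>

text \<open>
  A configuration \<open>\<omega>\<close> consists of the numbers \<open>fst \<omega> v\<close> of particles at the vertices and of the
  trajectories \<open>snd \<omega> (v, j)\<close>, all independent. The particles starting at \<open>v\<close> are those with
  index \<open>j < fst \<omega> v\<close>; the remaining trajectories are not used.
\<close>

type_synonym 'v config = "('v \<Rightarrow> nat) \<times> ('v \<times> nat \<Rightarrow> nat \<Rightarrow> 'v)"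

definition frog_model :: "('v \<Rightarrow> 'v pmf) \<Rightarrow> real \<Rightarrow> 'v config measure" where
  "frog_model Q lam =
     PiM UNIV (\<lambda>_. measure_pmf (poisson_pmf lam)) \<Otimes>\<^sub>M PiM UNIV (\<lambda>(v, j). walk_law Q v)"

lemma prob_space_frog_model: "prob_space (frog_model Q lam)"
  unfolding frog_model_def
  by (intro prob_space_pair prob_space_PiM)
     (auto intro: prob_space_walk_law measure_pmf.prob_space_axioms)

lemma space_frog_model: "space (frog_model Q lam) = UNIV"
  by (auto simp: frog_model_def space_pair_measure space_PiM space_walk_law)

definition hit_time :: "nat \<Rightarrow> 'v config \<Rightarrow> 'v \<Rightarrow> 'v \<Rightarrow> enat" where
  "hit_time l \<omega> v u = (INF k\<in>{k. k \<le> l \<and> (\<exists>j<fst \<omega> v. snd \<omega> (v, j) k = u)}. enat k)"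

definition activation_time :: "nat \<Rightarrow> 'v config \<Rightarrow> 'v \<Rightarrow> 'v \<Rightarrow> enat" where
  "activation_time l \<omega> w u = Inf {\<Sum>i<m. hit_time l \<omega> (p i) (p (Suc i)) | m p.
     p 0 = w \<and> p m = u \<and> (\<forall>i<m. hit_time l \<omega> (p i) (p (Suc i)) < \<infinity>)}"

definition activated :: "nat \<Rightarrow> 'v::zero config \<Rightarrow> real \<Rightarrow> 'v set" where
  "activated l \<omega> t = {u. ereal_of_enat (activation_time l \<omega> 0 u) \<le> ereal t}"

text \<open>
  The origin counts as activated at every time \<open>t \<ge> 0\<close>, even if it carries no particle.
  Hence a bound \<open>|A(cL)| / L^d < \<epsilon>\<close> can only hold when \<open>L^d > 1 / \<epsilon>\<close>.
\<close>

lemma origin_activated: "0 \<le> t \<Longrightarrow> 0 \<in> activated l \<omega> t"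
proof -
  assume "0 \<le> t"
  have "activation_time l \<omega> 0 0 \<le> 0"
    unfolding activation_time_def
    by (rule Inf_lower) (auto intro!: exI[of _ "0::nat"] exI[of _ "\<lambda>_. 0"])
  then show ?thesis using \<open>0 \<le> t\<close> by (auto simp: activated_def zero_ereal_def[symmetric])
qed

lemma finite_lattice_box: "finite (lattice_box L :: (int ^ 'd) set)"
proof -
  have "vec_nth ` (lattice_box L :: (int ^ 'd) set) \<subseteq> PiE UNIV (\<lambda>_. {\<lceil>-L\<rceil>..\<lfloor>L\<rfloor>})"
    by (auto simp: lattice_box_def PiE_iff ceiling_le_iff le_floor_iff)
  then have "finite (vec_nth ` (lattice_box L :: (int ^ 'd) set))"
    by (rule finite_subset) (auto intro: finite_PiE)
  then show ?thesis by (rule finite_imageD) (auto simp: inj_on_def vec_eq_iff)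
qed

lemma density_bound_only_if:
  fixes \<omega> :: "(int ^ 'd) config"
  assumes "0 < c" "0 < L" "0 < \<epsilon>" and sub: "activated l \<omega> (c * L) \<subseteq> lattice_box L"
    and less: "real (card (activated l \<omega> (c * L))) / L ^ CARD('d) < \<epsilon>"
  shows "1 / \<epsilon> < L ^ CARD('d)"
proof -
  have "finite (activated l \<omega> (c * L))" using sub finite_lattice_box by (rule finite_subset)
  then have "card (activated l \<omega> (c * L)) \<ge> 1"
    using origin_activated[of "c * L" l \<omega>] assms by (auto simp: Suc_le_eq card_gt_0_iff)
  then have "1 / L ^ CARD('d) \<le> real (card (activated l \<omega> (c * L))) / L ^ CARD('d)"
    using assms by (intro divide_right_mono) auto
  with less have "1 / L ^ CARD('d) < \<epsilon>" by linarith
  then show ?thesis using assms by (simp add: field_simps)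
qed

end

theory Submission
  imports Defs
begin

text \<open>
  Give each vertex the range of its particles, that is, the largest displacement that one of them
  attains within its lifespan. The ranges are independent and, up to an arbitrarily small loss in the
  exponent, their tail is \<open>r powr -\<alpha>\<close>. A path of length \<open>L\<close> makes \<open>N\<^sub>k\<close> jumps of size at
  least \<open>2 ^ k\<close>, each from a vertex of range at least \<open>2 ^ k\<close>. A union bound over all chains of such
  vertices with weight \<open>exp (n - s\<^sub>k L)\<close> costs a factor \<open>C s\<^sub>k powr -d\<close> per vertex of the chain.
  For \<open>s\<^sub>k = 2 powr -(\<beta> k)\<close> with \<open>1 < \<beta> < \<alpha> / d\<close> this is beaten by the probability
  \<open>2 powr -(\<alpha> k)\<close>. So with high probability \<open>N\<^sub>k \<le> s\<^sub>k L\<close> for all \<open>k \<ge> k\<^sub>0\<close>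
  and all paths from the origin at once. A path with \<open>m\<close> jumps then satisfies
  \<open>L \<le> 2 ^ k\<^sub>0 m + (\<Sum>k\<ge>k\<^sub>0. 2 ^ (k + 1) N\<^sub>k) \<le> 2 ^ k\<^sub>0 m + L / 2\<close>, because \<open>\<beta> > 1\<close>:
  within time \<open>t\<close> only vertices of norm at most \<open>2 ^ (k\<^sub>0 + 1) t\<close> are activated.
\<close>

section \<open>The lattice norm\<close>

definition vnorm :: "int ^ 'd \<Rightarrow> real" where
  "vnorm x = real_of_int (sup_norm x)"

lemma vnorm_le_iff: "vnorm x \<le> r \<longleftrightarrow> (\<forall>i. \<bar>real_of_int (x $ i)\<bar> \<le> r)"
proof -
  have "vnorm x \<le> r \<longleftrightarrow> sup_norm x \<le> \<lfloor>r\<rfloor>"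
    by (simp add: vnorm_def le_floor_iff)
  also have "\<dots> \<longleftrightarrow> (\<forall>i. \<bar>x $ i\<bar> \<le> \<lfloor>r\<rfloor>)"
    by (auto simp: sup_norm_def)
  finally show ?thesis by (simp add: le_floor_iff)
qed

lemma vnorm_ball_eq_lattice_box: "{x. vnorm x \<le> r} = lattice_box r"
proof -
  have "\<bar>a\<bar> \<le> r \<longleftrightarrow> a \<in> {- r..r}" for a :: real by auto
  then show ?thesis by (simp add: lattice_box_def vnorm_le_iff)
qed

lemma abs_component_le_vnorm: "\<bar>real_of_int (x $ i)\<bar> \<le> vnorm x"
  using vnorm_le_iff[of x "vnorm x"] by simp

lemma vnorm_nonneg: "0 \<le> vnorm x"
  using abs_component_le_vnorm[of x undefined] by linarith

lemma vnorm_zero [simp]: "vnorm 0 = 0"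
  using vnorm_nonneg[of 0] by (intro antisym) (auto simp: vnorm_le_iff)

lemma vnorm_triangle: "vnorm (x + y) \<le> vnorm x + vnorm y"
  unfolding vnorm_le_iff
proof
  fix i
  show "\<bar>real_of_int ((x + y) $ i)\<bar> \<le> vnorm x + vnorm y"
    using abs_component_le_vnorm[of x i] abs_component_le_vnorm[of y i] by simp
qed

lemma vnorm_triangle_diff: "vnorm (x - z) \<le> vnorm (x - y) + vnorm (y - z)"
  using vnorm_triangle[of "x - y" "y - z"] by simp

lemma vnorm_minus_commute: "vnorm (x - y) = vnorm (y - x)"
  by (intro antisym) (auto simp: vnorm_le_iff abs_minus_commute intro: order_trans[OF _ abs_component_le_vnorm])

lemma vnorm_less_one_iff: "vnorm x < 1 \<longleftrightarrow> x = 0"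
proof
  assume *: "vnorm x < 1"
  have "x $ i = 0" for i
  proof -
    have "real_of_int \<bar>x $ i\<bar> < 1" using abs_component_le_vnorm[of x i] * by simp
    then show ?thesis by linarith
  qed
  then show "x = 0" by (simp add: vec_eq_iff)
qed simp

lemma card_vnorm_ball:
  assumes "0 \<le> r"
  shows "real (card {x :: int ^ 'd. vnorm x \<le> r}) \<le> (2 * r + 1) ^ CARD('d)"
proof -
  have fin: "finite (PiE (UNIV :: 'd set) (\<lambda>_. {-\<lfloor>r\<rfloor>..\<lfloor>r\<rfloor>}))"
    by (intro finite_PiE) auto
  have "vec_nth ` {x :: int ^ 'd. vnorm x \<le> r} \<subseteq> PiE UNIV (\<lambda>_. {-\<lfloor>r\<rfloor>..\<lfloor>r\<rfloor>})"
    by (auto simp: vnorm_le_iff PiE_iff le_floor_iff minus_le_iff[of "\<lfloor>r\<rfloor>"] abs_le_iff)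
  from card_mono[OF fin this] have "card {x :: int ^ 'd. vnorm x \<le> r} \<le> nat (2 * \<lfloor>r\<rfloor> + 1) ^ CARD('d)"
    by (simp add: card_image inj_on_def vec_eq_iff card_PiE)
  then have "real (card {x :: int ^ 'd. vnorm x \<le> r}) \<le> real (nat (2 * \<lfloor>r\<rfloor> + 1)) ^ CARD('d)"
    by (metis of_nat_le_iff of_nat_power)
  also have "\<dots> \<le> (2 * r + 1) ^ CARD('d)"
    using assms by (intro power_mono) auto
  finally show ?thesis .
qed

section \<open>Summable weights on the lattice\<close>

lemma summable_powr_int:
  assumes "1 < b"
  shows "Infinite_Set_Sum.abs_summable_on (\<lambda>n :: int. (1 + \<bar>real_of_int n\<bar>) powr - b) UNIV"
proof -
  let ?f = "\<lambda>n :: int. (1 + \<bar>real_of_int n\<bar>) powr - b"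
  have "summable (\<lambda>n. real (Suc n) powr - b)"
    by (subst summable_Suc_iff) (use assms in \<open>simp add: summable_real_powr_iff\<close>)
  then have nat: "Infinite_Set_Sum.abs_summable_on (\<lambda>n. real (Suc n) powr - b) UNIV"
    by (simp add: abs_summable_on_nat_iff')
  have "Infinite_Set_Sum.abs_summable_on ?f (range int)"
    by (subst abs_summable_on_reindex_iff[symmetric]) (use nat in \<open>auto simp: add.commute\<close>)
  moreover have "Infinite_Set_Sum.abs_summable_on ?f (range (\<lambda>n. - int n))"
    by (subst abs_summable_on_reindex_iff[symmetric]) (use nat in \<open>auto simp: add.commute inj_on_def\<close>)
  ultimately have "Infinite_Set_Sum.abs_summable_on ?f ((range int \<union> range (\<lambda>n. - int n)))"
    by (rule abs_summable_on_union)
  moreover have "range int \<union> range (\<lambda>n. - int n) = UNIV"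
    by (auto, metis int_cases2 rangeI)
  ultimately show ?thesis by simp
qed

text \<open>
  Each coordinate is at most the norm, so the weight is dominated by a product of
  one-dimensional weights with exponent \<open>b / CARD('d) > 1\<close>.
\<close>

lemma nn_integral_vnorm_powr_finite:
  assumes "real CARD('d) < b"
  shows "(\<integral>\<^sup>+u. ennreal ((1 + vnorm (u :: int ^ 'd)) powr - b) \<partial>count_space UNIV) < \<infinity>"
proof -
  let ?d = "real CARD('d)"
  let ?f = "\<lambda>n :: int. (1 + \<bar>real_of_int n\<bar>) powr - (b / ?d)"
  have d: "?d > 0" by simp
  have "Infinite_Set_Sum.abs_summable_on (\<lambda>g. \<Prod>i\<in>(UNIV :: 'd set). ?f (g i)) (PiE UNIV (\<lambda>_. UNIV))"
    by (intro abs_summable_on_prod_PiE summable_powr_int) (use assms d in \<open>auto simp: field_simps\<close>)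
  then have s: "Infinite_Set_Sum.abs_summable_on (\<lambda>u :: int ^ 'd. \<Prod>i\<in>UNIV. ?f (u $ i)) UNIV"
    by (subst abs_summable_on_reindex_bij_betw[symmetric, of vec_lambda "PiE UNIV (\<lambda>_. UNIV)"])
      (auto intro!: bij_betwI[of _ _ _ vec_nth] simp: PiE_UNIV_domain)
  have le: "(1 + vnorm u) powr - b \<le> (\<Prod>i\<in>UNIV. ?f (u $ i))" for u :: "int ^ 'd"
  proof -
    have "(1 + vnorm u) powr - b = (\<Prod>i\<in>(UNIV :: 'd set). (1 + vnorm u) powr - (b / ?d))"
      using vnorm_nonneg[of u] d by (simp add: powr_powr flip: powr_realpow)
    also have "\<dots> \<le> (\<Prod>i\<in>UNIV. ?f (u $ i))"
      using assms d abs_component_le_vnorm[of u] by (intro prod_mono) (auto intro!: powr_mono2' simp: )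
    finally show ?thesis .
  qed
  have "(\<integral>\<^sup>+u. ennreal ((1 + vnorm (u :: int ^ 'd)) powr - b) \<partial>count_space UNIV) \<le>
    (\<integral>\<^sup>+u. ennreal (\<Prod>i\<in>UNIV. ?f ((u :: int ^ 'd) $ i)) \<partial>count_space UNIV)"
    by (intro nn_integral_mono) (use le in \<open>auto intro!: ennreal_leI\<close>)
  also have "\<dots> < \<infinity>"
    by (subst nn_integral_conv_infsetsum[OF s]) (auto intro: prod_nonneg)
  finally show ?thesis .
qed

text \<open>The true order is \<open>s powr -d\<close> with \<open>d\<close> the dimension; giving
  up a little in the exponent reduces the sum to a convergent power sum. The inequality
  \<open>(x / b) powr b \<le> exp x\<close> at \<open>x = s * (1 + vnorm u)\<close> yields the power
  weight, and \<open>s \<le> 1\<close> bounds the factor \<open>exp s\<close> that the shift by 1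
  leaves over.\<close>

lemma nn_integral_exp_vnorm_le:
  assumes "real CARD('d) < b"
  obtains C where "0 < C" "\<And>s. 0 < s \<Longrightarrow> s \<le> 1 \<Longrightarrow>
    (\<integral>\<^sup>+u. ennreal (exp (- s * vnorm (u :: int ^ 'd))) \<partial>count_space UNIV) \<le> ennreal (C * s powr - b)"
proof -
  obtain S where S: "0 \<le> S" and Seq: "(\<integral>\<^sup>+u. ennreal ((1 + vnorm (u :: int ^ 'd)) powr - b) \<partial>count_space UNIV) = ennreal S"
    using nn_integral_vnorm_powr_finite[OF assms]
    by (cases "\<integral>\<^sup>+u. ennreal ((1 + vnorm (u :: int ^ 'd)) powr - b) \<partial>count_space UNIV") auto
  have b: "b > 0" using assms by (rule order.strict_trans[rotated]) simp
  define C where "C = exp 1 * b powr b * (S + 1)"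
  have "(\<integral>\<^sup>+u. ennreal (exp (- s * vnorm (u :: int ^ 'd))) \<partial>count_space UNIV) \<le> ennreal (C * s powr - b)"
    if s: "0 < s" "s \<le> 1" for s
  proof -
    have le: "exp (- s * vnorm u) \<le> exp 1 * b powr b * s powr - b * (1 + vnorm u) powr - b" for u :: "int ^ 'd"
    proof -
      define x where "x = s * (1 + vnorm u)"
      have x: "x > 0" using s vnorm_nonneg[of u] by (simp add: x_def)
      have "x / b \<le> exp (x / b)" using exp_ge_add_one_self[of "x / b"] by linarith
      then have "(x / b) powr b \<le> exp (x / b) powr b" using b x by (intro powr_mono2) auto
      also have "\<dots> = exp x" using b by (simp add: powr_def)
      finally have "(x / b) powr b \<le> exp x" .
      then have "exp (- x) \<le> b powr b * x powr - b"
        using b x by (simp add: powr_divide powr_minus exp_minus field_simps)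
      moreover have "exp (- s * vnorm u) = exp s * exp (- x)"
        by (simp add: x_def algebra_simps flip: exp_add)
      moreover have "exp s * exp (- x) \<le> exp 1 * exp (- x)" using s by simp
      moreover have "x powr - b = s powr - b * (1 + vnorm u) powr - b"
        unfolding x_def using s vnorm_nonneg[of u] by (subst powr_mult) auto
      ultimately show ?thesis
        by (smt (verit, best) exp_gt_zero mult.assoc mult_left_mono)
    qed
    have "(\<integral>\<^sup>+u. ennreal (exp (- s * vnorm (u :: int ^ 'd))) \<partial>count_space UNIV) \<le>
      (\<integral>\<^sup>+u. ennreal (exp 1 * b powr b * s powr - b) * ennreal ((1 + vnorm (u :: int ^ 'd)) powr - b) \<partial>count_space UNIV)"
      using le by (intro nn_integral_mono) (auto simp flip: ennreal_mult)
    also have "\<dots> = ennreal (exp 1 * b powr b * s powr - b * S)"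
      by (subst nn_integral_cmult) (auto simp: Seq S ennreal_mult')
    also have "\<dots> \<le> ennreal (C * s powr - b)"
      using s S by (intro ennreal_leI) (auto simp: C_def field_simps)
    finally show ?thesis .
  qed
  moreover have "C > 0" using b S by (simp add: C_def)
  ultimately show ?thesis using that by blast
qed

text \<open>The exponent \<open>d + \<alpha>\<close> is split as \<open>a + b\<close>. The power
  with \<open>a\<close> is at most \<open>r powr -a\<close> on the region of summation, and the
  power with \<open>b > d\<close> is summable.\<close>

lemma nn_integral_kernel_tail_le:
  fixes Q :: "int ^ 'd \<Rightarrow> (int ^ 'd) pmf"
  assumes "heavy_tailed \<alpha> Q" "a < \<alpha>" "0 < a"
  obtains C where "0 < C" "\<And>x r. 1 \<le> r \<Longrightarrow>
    (\<integral>\<^sup>+y. ennreal (pmf (Q x) y) * indicator {y. r \<le> vnorm (y - x)} y \<partial>count_space UNIV) \<le> ennreal (C * r powr - a)"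
proof -
  let ?d = "real CARD('d)"
  obtain K where K: "K > 0" and Kle: "\<And>x y. x \<noteq> y \<Longrightarrow> pmf (Q x) y \<le> K * vnorm (x - y) powr - (?d + \<alpha>)"
    using assms(1) unfolding heavy_tailed_def vnorm_def by blast
  define b where "b = ?d + \<alpha> - a"
  have b: "?d < b" "b > 0" using assms by (auto simp: b_def intro: add_pos_pos)
  obtain S where S: "0 \<le> S" and Seq: "(\<integral>\<^sup>+u. ennreal ((1 + vnorm (u :: int ^ 'd)) powr - b) \<partial>count_space UNIV) = ennreal S"
    using nn_integral_vnorm_powr_finite[OF b(1)]
    by (cases "\<integral>\<^sup>+u. ennreal ((1 + vnorm (u :: int ^ 'd)) powr - b) \<partial>count_space UNIV") auto
  define C where "C = K * 2 powr b * (S + 1)"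
  have "(\<integral>\<^sup>+y. ennreal (pmf (Q x) y) * indicator {y. r \<le> vnorm (y - x)} y \<partial>count_space UNIV) \<le> ennreal (C * r powr - a)"
    if r: "1 \<le> r" for x r
  proof -
    have le: "pmf (Q x) y \<le> K * 2 powr b * r powr - a * (1 + vnorm (y - x)) powr - b" if y: "r \<le> vnorm (y - x)" for y
    proof -
      let ?n = "vnorm (y - x)"
      have "x \<noteq> y" using y r by auto
      from Kle[OF this] have "pmf (Q x) y \<le> K * ?n powr - (?d + \<alpha>)" by (simp add: vnorm_minus_commute)
      also have "- (?d + \<alpha>) = - a + - b" by (simp add: b_def)
      also have "?n powr (- a + - b) = ?n powr - a * ?n powr - b" by (rule powr_add)
      \<comment> \<open>As \<open>?n \<ge> r \<ge> 1\<close>, the mean of 1 and \<open>?n\<close> is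
        at most \<open>?n\<close>. The weight in \<open>1 + ?n\<close> can then be summed over the
        whole lattice.\<close>
      also have "?n powr - b \<le> ((1 + ?n) / 2) powr - b" using y r b by (intro powr_mono2') auto
      also have "((1 + ?n) / 2) powr - b = 2 powr b * (1 + ?n) powr - b"
        using y r by (subst powr_divide) (auto simp: powr_minus field_simps)
      also have "?n powr - a \<le> r powr - a" using y r assms by (intro powr_mono2') auto
      finally show ?thesis using K by (simp add: mult_ac mult_left_mono mult_right_mono)
    qed
    have "(\<integral>\<^sup>+y. ennreal (pmf (Q x) y) * indicator {y. r \<le> vnorm (y - x)} y \<partial>count_space UNIV) \<le>
      (\<integral>\<^sup>+y. ennreal (K * 2 powr b * r powr - a) * ennreal ((1 + vnorm (y - x)) powr - b) \<partial>count_space UNIV)"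
      using le K by (intro nn_integral_mono) (auto simp flip: ennreal_mult split: split_indicator intro!: ennreal_leI)
    also have "\<dots> = ennreal (K * 2 powr b * r powr - a) * (\<integral>\<^sup>+y. ennreal ((1 + vnorm (y - x)) powr - b) \<partial>count_space UNIV)"
      by (subst nn_integral_cmult) auto
    also have "(\<integral>\<^sup>+y. ennreal ((1 + vnorm (y - x)) powr - b) \<partial>count_space UNIV) = ennreal S"
      unfolding Seq[symmetric]
      by (rule nn_integral_bij_count_space) (auto intro!: bij_betwI[of _ _ _ "\<lambda>u. u + x"])
    also have "ennreal (K * 2 powr b * r powr - a) * ennreal S \<le> ennreal (C * r powr - a)"
      using K S r by (subst ennreal_mult[symmetric]) (auto simp: C_def field_simps intro!: ennreal_leI)
    finally show ?thesis .
  qed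
  moreover have "C > 0" using K S by (simp add: C_def)
  ultimately show ?thesis using that by blast
qed

section \<open>The range of a walk\<close>

lemma sets_walk_pred:
  assumes "Measurable.pred (PiM UNIV (\<lambda>_. count_space UNIV)) P"
  shows "{X. P X} \<in> sets (walk_law Q v)"
  using assms by (simp add: pred_def sets_walk_law space_PiM)

text \<open>Markov property at time \<open>i\<close>: the event is split by the past
  \<open>xs\<close> up to time \<open>i\<close> and the next position \<open>y\<close>. Cylinder
  probabilities factor, and the sum over \<open>y\<close> is at most \<open>h\<close> whatever the
  past.\<close>

lemma emeasure_walk_jump_le:
  fixes Q :: "'v :: countable \<Rightarrow> 'v pmf"
  assumes tail: "\<And>x. (\<integral>\<^sup>+y. ennreal (pmf (Q x) y) * indicator {y. R x y} y \<partial>count_space UNIV) \<le> h"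
  shows "emeasure (walk_law Q v) {X. R (X i) (X (Suc i))} \<le> h"
proof -
  let ?M = "walk_law Q v"
  interpret prob_space ?M by (rule prob_space_walk_law)
  \<comment> \<open>Lists of the wrong length get the empty set, so the index ranges over the whole
    countable type of lists.\<close>
  define Y where "Y xs = (if length xs = Suc i then {X. \<forall>j\<le>i. X j = xs ! j} else {})" for xs :: "'v list"
  define Z where "Z = (\<lambda>(xs, y). if R (xs ! i) y \<and> length xs = Suc i
    then {X. \<forall>j\<le>Suc i. X j = (xs @ [y]) ! j} else {})"
  have Y_sets: "Y xs \<in> sets ?M" for xs
    unfolding Y_def by (auto intro!: sets_walk_pred)
  have Z_sets: "Z p \<in> sets ?M" for p
    unfolding Z_def by (cases p) (auto intro!: sets_walk_pred)
  have Y_disj: "disjoint_family_on Y UNIV"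
    unfolding disjoint_family_on_def Y_def by (auto simp: list_eq_iff_nth_eq less_Suc_eq_le)
  have Z_iff: "X \<in> Z (xs, y) \<longleftrightarrow> R (xs ! i) y \<and> X \<in> Y xs \<and> X (Suc i) = y" for X xs y
    by (auto simp: Z_def Y_def nth_append le_Suc_eq)
  have Z_disj: "disjoint_family_on Z UNIV"
    using Y_disj unfolding disjoint_family_on_def by (auto simp: Z_iff) blast
  have ZE: "emeasure ?M (Z (xs, y)) = ennreal (pmf (Q (xs ! i)) y) * indicator {y. R (xs ! i) y} y * emeasure ?M (Y xs)" for xs y
  proof (cases "R (xs ! i) y \<and> length xs = Suc i")
    case True
    have "(\<Prod>j<Suc i. pmf (Q ((xs @ [y]) ! j)) ((xs @ [y]) ! Suc j)) =
      (\<Prod>j<i. pmf (Q (xs ! j)) (xs ! Suc j)) * pmf (Q (xs ! i)) y"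
      using True by (simp add: nth_append)
    then show ?thesis using True
      by (simp add: Z_def Y_def emeasure_walk_cylinder nth_append ennreal_mult prod_nonneg mult.commute del: prod.lessThan_Suc)
  qed (auto simp: Z_def Y_def)
  have "{X. R (X i) (X (Suc i))} \<subseteq> (\<Union>p. Z p)"
  proof
    fix X assume "X \<in> {X. R (X i) (X (Suc i))}"
    then have "X \<in> Z (map X [0..<Suc i], X (Suc i))" by (simp add: Z_iff Y_def nth_append del: upt_Suc)
    then show "X \<in> (\<Union>p. Z p)" by blast
  qed
  then have "emeasure ?M {X. R (X i) (X (Suc i))} \<le> emeasure ?M (\<Union>p. Z p)"
    using Z_sets by (intro emeasure_mono) auto
  also have "\<dots> = (\<integral>\<^sup>+p. emeasure ?M (Z p) \<partial>count_space UNIV)"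
    using Z_sets Z_disj by (intro emeasure_UN_countable) auto
  also have "\<dots> = (\<integral>\<^sup>+xs. \<integral>\<^sup>+y. emeasure ?M (Z (xs, y)) \<partial>count_space UNIV \<partial>count_space UNIV)"
    by (rule nn_integral_fst_count_space[symmetric])
  also have "\<dots> = (\<integral>\<^sup>+xs. (\<integral>\<^sup>+y. ennreal (pmf (Q (xs ! i)) y) * indicator {y. R (xs ! i) y} y \<partial>count_space UNIV) *
      emeasure ?M (Y xs) \<partial>count_space UNIV)"
    unfolding ZE by (intro nn_integral_cong nn_integral_multc) auto
  also have "\<dots> \<le> (\<integral>\<^sup>+xs. h * emeasure ?M (Y xs) \<partial>count_space UNIV)"
    using tail by (intro nn_integral_mono mult_right_mono) auto
  also have "\<dots> = h * (\<integral>\<^sup>+xs. emeasure ?M (Y xs) \<partial>count_space UNIV)"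
    by (rule nn_integral_cmult) auto
  also have "(\<integral>\<^sup>+xs. emeasure ?M (Y xs) \<partial>count_space UNIV) = emeasure ?M (\<Union>xs. Y xs)"
    using Y_sets Y_disj by (intro emeasure_UN_countable[symmetric]) auto
  also have "h * \<dots> \<le> h * 1"
    by (intro mult_left_mono emeasure_le_1) auto
  finally show ?thesis by simp
qed

lemma emeasure_walk_start: "emeasure (walk_law Q v) {X. X 0 \<noteq> v} = 0"
proof -
  interpret prob_space "walk_law Q v" by (rule prob_space_walk_law)
  have "emeasure (walk_law Q v) {X. X 0 = v} = 1"
    using emeasure_walk_cylinder[of Q v 0 "\<lambda>_. v"] by simp
  then have "AE X in walk_law Q v. X \<in> {X. X 0 = v}"
    by (intro AE_prob_1) (simp add: measure_def)
  then show ?thesis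
    by (subst (asm) AE_iff_measurable[OF _ refl]) (auto simp: space_walk_law intro!: sets_walk_pred)
qed

text \<open>The event that a particle has range at least \<open>r\<close>. Displacement is measured
  from the prescribed start \<open>v\<close> rather than from \<open>X 0\<close>, which equals
  \<open>v\<close> only almost surely.\<close>

definition wanders :: "nat \<Rightarrow> real \<Rightarrow> int ^ 'd \<Rightarrow> (nat \<Rightarrow> int ^ 'd) \<Rightarrow> bool" where
  "wanders l r v X \<longleftrightarrow> (\<exists>i\<le>l. r \<le> vnorm (X i - v))"

lemma measurable_wanders [measurable]:
  "Measurable.pred (PiM UNIV (\<lambda>_. count_space UNIV)) (wanders l r v)"
  unfolding wanders_def by measurable

lemma vnorm_walk_le:
  assumes "\<And>i. i < n \<Longrightarrow> vnorm (X (Suc i) - X i) \<le> r"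
  shows "vnorm (X n - X 0) \<le> real n * r"
  using assms
proof (induction n)
  case (Suc n)
  then show ?case
    using vnorm_triangle_diff[of "X (Suc n)" "X 0" "X n"] by (force simp: algebra_simps)
qed simp

text \<open>For a walk started at \<open>v\<close>, a displacement of \<open>r\<close> within
  \<open>l\<close> steps forces one of the first \<open>l\<close> jumps to have size at least
  \<open>r / l\<close>. As \<open>l\<close> is fixed, the loss goes into the constant;
  \<open>r \<ge> l\<close> keeps \<open>r / l \<ge> 1\<close>.\<close>

lemma emeasure_wanders_le:
  fixes Q :: "int ^ 'd \<Rightarrow> (int ^ 'd) pmf"
  assumes "heavy_tailed \<alpha> Q" "a < \<alpha>" "0 < a" "1 \<le> l"
  obtains C where "0 < C" "\<And>v r. real l \<le> r \<Longrightarrow>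
    emeasure (walk_law Q v) {X. wanders l r v X} \<le> ennreal (C * r powr - a)"
proof -
  from nn_integral_kernel_tail_le[OF assms(1-3)] obtain C where C: "0 < C" "\<And>x r. 1 \<le> r \<Longrightarrow>
    (\<integral>\<^sup>+y. ennreal (pmf (Q x) y) * indicator {y. r \<le> vnorm (y - x)} y \<partial>count_space UNIV) \<le> ennreal (C * r powr - a)"
    by blast
  define D where "D = real l * (C * real l powr a)"
  have "emeasure (walk_law Q v) {X. wanders l r v X} \<le> ennreal (D * r powr - a)" if r: "real l \<le> r" for v r
  proof -
    let ?M = "walk_law Q v"
    let ?J = "\<lambda>i. {X. r / l \<le> vnorm (X (Suc i) - X i)}"
    have l: "l > 0" and r0: "r > 0" using assms(4) r by auto
    have J: "emeasure ?M (?J i) \<le> ennreal (C * (r / l) powr - a)" for i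
      by (rule emeasure_walk_jump_le) (use C(2)[of "r / l"] r l in \<open>simp add: field_simps\<close>)
    have sets: "{X. X 0 \<noteq> v} \<in> sets ?M" "?J i \<in> sets ?M" for i
      by (auto intro!: sets_walk_pred)
    have "{X. wanders l r v X} \<subseteq> {X. X 0 \<noteq> v} \<union> (\<Union>i<l. ?J i)"
    proof (rule ccontr)
      assume "\<not> ?thesis"
      then obtain X where X: "wanders l r v X" "X 0 = v" and "\<And>i. i < l \<Longrightarrow> vnorm (X (Suc i) - X i) < r / l"
        by force
      from this(3) have small: "\<And>i. i < l \<Longrightarrow> vnorm (X (Suc i) - X i) < r / l" .
      from X obtain n where n: "n \<le> l" "r \<le> vnorm (X n - v)" by (auto simp: wanders_def)
      \<comment> \<open>The maximum turns the strict bounds on the jumps into the strict bound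
        \<open>l * m < r\<close>; the inserted 0 gives \<open>m \<ge> 0\<close>, so that
        \<open>n\<close> may be enlarged to \<open>l\<close>.\<close>
      define m where "m = Max (insert 0 ((\<lambda>i. vnorm (X (Suc i) - X i)) ` {..<l}))"
      have m: "m < r / l" unfolding m_def using small r0 l by (subst Max_less_iff) auto
      have "vnorm (X n - X 0) \<le> real n * m"
        by (rule vnorm_walk_le) (use n in \<open>auto simp: m_def intro!: Max_ge\<close>)
      also have "\<dots> \<le> real l * m" using n by (intro mult_right_mono) (auto simp: m_def)
      also have "\<dots> < r" using m l by (simp add: field_simps)
      finally show False using n X by simp
    qed
    then have "emeasure ?M {X. wanders l r v X} \<le> emeasure ?M ({X. X 0 \<noteq> v} \<union> (\<Union>i<l. ?J i))"
      using sets by (intro emeasure_mono sets.Un sets.finite_UN) auto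
    also have "\<dots> \<le> emeasure ?M {X. X 0 \<noteq> v} + emeasure ?M (\<Union>i<l. ?J i)"
      using sets by (intro emeasure_subadditive sets.finite_UN) auto
    also have "\<dots> \<le> 0 + (\<Sum>i<l. emeasure ?M (?J i))"
      using sets by (intro add_mono emeasure_subadditive_finite) (auto simp: emeasure_walk_start)
    also have "\<dots> \<le> (\<Sum>i<l. ennreal (C * (r / l) powr - a))"
      by (simp only: add_0) (intro sum_mono J)
    also have "\<dots> = ennreal (real l * (C * (r / l) powr - a))"
      using C(1) by (subst sum_ennreal) auto
    also have "real l * (C * (r / l) powr - a) = D * r powr - a"
      using r0 l by (simp add: D_def powr_divide powr_minus field_simps)
    finally show ?thesis .
  qed
  moreover have "D > 0" using C(1) assms(4) by (simp add: D_def)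
  ultimately show ?thesis using that by blast
qed

section \<open>Chains of particles\<close>

lemma sets_frog_model:
  "sets (frog_model Q lam) =
    sets (PiM UNIV (\<lambda>_. count_space UNIV) \<Otimes>\<^sub>M PiM UNIV (\<lambda>_. PiM UNIV (\<lambda>_. count_space UNIV)))"
  unfolding frog_model_def
  by (intro sets_pair_measure_cong sets_PiM_cong) (auto simp: sets_walk_law)

lemma sets_frog_pred:
  assumes "Measurable.pred (PiM UNIV (\<lambda>_. count_space UNIV) \<Otimes>\<^sub>M PiM UNIV (\<lambda>_. PiM UNIV (\<lambda>_. count_space UNIV))) P"
  shows "{\<omega>. P \<omega>} \<in> sets (frog_model Q lam)"
  using assms by (simp add: pred_def sets_frog_model space_PiM space_pair_measure)

lemma measurable_frog_fst [measurable]: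
  "(\<lambda>\<omega>. fst \<omega> v) \<in> measurable (PiM UNIV (\<lambda>_. count_space UNIV) \<Otimes>\<^sub>M N) (count_space UNIV)"
  by measurable

lemma measurable_frog_snd [measurable]:
  "(\<lambda>\<omega>. snd \<omega> p) \<in> measurable (N \<Otimes>\<^sub>M PiM UNIV (\<lambda>_. PiM UNIV (\<lambda>_. count_space UNIV))) (PiM UNIV (\<lambda>_. count_space UNIV))"
  by measurable

text \<open>The sum is the mean number of particles at a vertex; \<open>n < 2 ^ n\<close> compares
  it with an exponential series.\<close>

lemma poisson_tail_sum_finite:
  assumes "lam > 0"
  shows "(\<Sum>j. emeasure (measure_pmf (poisson_pmf lam)) {n. j < n}) < \<infinity>"
proof -
  have "(\<Sum>j. emeasure (measure_pmf (poisson_pmf lam)) {n. j < n}) = (\<integral>\<^sup>+n. of_nat n \<partial>measure_pmf (poisson_pmf lam))"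
    using nn_integral_nat_function[of "\<lambda>n. n" "measure_pmf (poisson_pmf lam)"] by simp
  also have "\<dots> = (\<integral>\<^sup>+n. ennreal (pmf (poisson_pmf lam) n) * of_nat n \<partial>count_space UNIV)"
    by (rule nn_integral_measure_pmf)
  also have "\<dots> \<le> (\<integral>\<^sup>+n. ennreal ((2 * lam) ^ n / fact n) \<partial>count_space UNIV)"
  proof (rule nn_integral_mono)
    fix n
    have "lam ^ n / fact n * exp (- lam) * real n \<le> lam ^ n / fact n * 1 * 2 ^ n"
      using assms of_nat_less_two_power[of n] by (intro mult_mono) (auto simp: less_imp_le)
    then show "ennreal (pmf (poisson_pmf lam) n) * of_nat n \<le> ennreal ((2 * lam) ^ n / fact n)"
      using assms by (auto simp: ennreal_of_nat_eq_real_of_nat power_mult_distrib mult_ac simp flip: ennreal_mult intro!: ennreal_leI)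
  qed
  also have "\<dots> < \<infinity>"
  proof -
    have "summable (\<lambda>n. (2 * lam) ^ n / fact n)"
      using summable_exp[of "2 * lam"] by (simp add: divide_inverse mult.commute)
    then show ?thesis
      using assms by (simp add: nn_integral_count_space_nat less_top[symmetric] ennreal_suminf_neq_top)
  qed
  finally show ?thesis .
qed

text \<open>Independence. Distinct vertices put each condition on a separate count and a separate
  trajectory; the probabilities of two conditions on one Poisson count need not multiply.
  \<open>J\<close> recovers the index attached to a vertex.\<close>

lemma emeasure_frog_chain:
  fixes Q :: "'v \<Rightarrow> 'v pmf"
  assumes dist: "distinct (map fst ws)"
    and B: "\<And>v. Measurable.pred (PiM UNIV (\<lambda>_. count_space UNIV)) (B v)"
  shows "emeasure (frog_model Q lam) {\<omega>. \<forall>(v, j)\<in>set ws. j < fst \<omega> v \<and> B v (snd \<omega> (v, j))} =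
    (\<Prod>(v, j)\<leftarrow>ws. emeasure (measure_pmf (poisson_pmf lam)) {n. j < n} * emeasure (walk_law Q v) {X. B v X})"
proof -
  let ?P = "\<lambda>_ :: 'v. measure_pmf (poisson_pmf lam)"
  let ?W = "\<lambda>(v, j :: nat). walk_law Q v"
  define J where "J v = the (map_of ws v)" for v
  have J: "J v = j" if "(v, j) \<in> set ws" for v j
    using that dist by (simp add: J_def)
  have inj: "inj_on fst (set ws)" using dist by (simp add: distinct_map)
  interpret W: prob_space "PiM UNIV ?W"
    by (intro prob_space_PiM) (auto intro: prob_space_walk_law)
  let ?A1 = "prod_emb UNIV ?P (fst ` set ws) (PiE (fst ` set ws) (\<lambda>v. {n. J v < n}))"
  let ?A2 = "prod_emb UNIV ?W (set ws) (PiE (set ws) (\<lambda>(v, j). {X. B v X}))"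
  have eq: "{\<omega>. \<forall>(v, j)\<in>set ws. j < fst \<omega> v \<and> B v (snd \<omega> (v, j))} = ?A1 \<times> ?A2"
    using J by (fastforce simp: prod_emb_iff PiE_iff space_walk_law)
  have s1: "?A1 \<in> sets (PiM UNIV ?P)" by (intro sets_PiM_I) auto
  have s2: "?A2 \<in> sets (PiM UNIV ?W)" by (intro sets_PiM_I) (auto intro!: sets_walk_pred B)
  have "emeasure (frog_model Q lam) (?A1 \<times> ?A2) = emeasure (PiM UNIV ?P) ?A1 * emeasure (PiM UNIV ?W) ?A2"
    unfolding frog_model_def using s1 s2 by (rule W.emeasure_pair_measure_Times)
  also have "emeasure (PiM UNIV ?P) ?A1 = (\<Prod>v\<in>fst ` set ws. emeasure (?P v) {n. J v < n})"
    by (intro emeasure_PiM_emb) (auto intro: measure_pmf.prob_space_axioms)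
  also have "\<dots> = (\<Prod>(v, j)\<in>set ws. emeasure (?P v) {n. j < n})"
    using J by (subst prod.reindex[OF inj]) (auto intro!: prod.cong)
  also have "emeasure (PiM UNIV ?W) ?A2 = (\<Prod>p\<in>set ws. emeasure (?W p) ((\<lambda>(v, j). {X. B v X}) p))"
    by (intro emeasure_PiM_emb) (auto intro!: prob_space_walk_law sets_walk_pred B)
  finally have "emeasure (frog_model Q lam) (?A1 \<times> ?A2) =
    (\<Prod>(v, j)\<in>set ws. emeasure (?P v) {n. j < n} * emeasure (walk_law Q v) {X. B v X})"
    by (simp add: prod.distrib[symmetric] split_def)
  also have "\<dots> = (\<Prod>(v, j)\<leftarrow>ws. emeasure (?P v) {n. j < n} * emeasure (walk_law Q v) {X. B v X})"
    using dist by (intro prod.distinct_set_conv_list) (auto simp: distinct_map)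
  finally show ?thesis unfolding eq .
qed

section \<open>Union bound over chains\<close>

fun path_length :: "int ^ 'd \<Rightarrow> (int ^ 'd) list \<Rightarrow> real" where
  "path_length x [] = 0"
| "path_length x (y # ys) = vnorm (y - x) + path_length y ys"

text \<open>With \<open>g\<close> the Poisson tail, \<open>g j\<close> pays for the presence of
  particle \<open>j\<close>, and the exponential pays for distance. The recursion carries the
  current vertex, which lets a sum over chains be taken one entry at a time.\<close>

fun chain_weight :: "(nat \<Rightarrow> ennreal) \<Rightarrow> real \<Rightarrow> int ^ 'd \<Rightarrow> ((int ^ 'd) \<times> nat) list \<Rightarrow> ennreal" where
  "chain_weight g s x [] = 1"
| "chain_weight g s x ((v, j) # ws) = g j * ennreal (exp (- s * vnorm (v - x))) * chain_weight g s v ws"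

lemma chain_weight_eq:
  "chain_weight g s x ws = (\<Prod>(v, j)\<leftarrow>ws. g j) * ennreal (exp (- s * path_length x (map fst ws)))"
proof (induction ws arbitrary: x)
  case (Cons w ws)
  have "ennreal (exp (- s * path_length x (map fst (w # ws)))) =
    ennreal (exp (- s * vnorm (fst w - x))) * ennreal (exp (- s * path_length (fst w) (map fst ws)))"
    by (simp add: algebra_simps flip: exp_add ennreal_mult)
  with Cons show ?case by (cases w) (simp add: mult_ac)
qed simp

text \<open>By translation invariance the sum over the remaining entries does not depend on the
  vertex reached, so every entry contributes the same factor.\<close>

lemma nn_integral_chain_weight:
  "(\<integral>\<^sup>+ws. chain_weight g s (x :: int ^ 'd) ws \<partial>count_space {ws. length ws = n}) =
    ((\<Sum>j. g j) * (\<integral>\<^sup>+u. ennreal (exp (- s * vnorm (u :: int ^ 'd))) \<partial>count_space UNIV)) ^ n"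
proof (induction n arbitrary: x)
  case 0
  have "{ws :: ((int ^ 'd) \<times> nat) list. length ws = 0} = {[]}" by auto
  then show ?case by (simp add: nn_integral_count_space_finite)
next
  case (Suc n)
  let ?E = "\<integral>\<^sup>+u. ennreal (exp (- s * vnorm (u :: int ^ 'd))) \<partial>count_space UNIV"
  let ?L = "{ws :: ((int ^ 'd) \<times> nat) list. length ws = n}"
  let ?q = "((\<Sum>j. g j) * ?E) ^ n"
  have E: "(\<integral>\<^sup>+v. ennreal (exp (- s * vnorm (v - x))) \<partial>count_space UNIV) = ?E"
    by (rule nn_integral_bij_count_space) (auto intro!: bij_betwI[of _ _ _ "\<lambda>u. u + x"])
  have "(\<integral>\<^sup>+ws. chain_weight g s x ws \<partial>count_space {ws. length ws = Suc n}) =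
    (\<integral>\<^sup>+p. chain_weight g s x ((\<lambda>(a, ws). a # ws) p) \<partial>count_space (UNIV \<times> ?L))"
    by (rule nn_integral_bij_count_space[symmetric])
      (auto simp: length_Suc_conv intro!: bij_betwI[of _ _ _ "\<lambda>ws. (hd ws, tl ws)"])
  also have "count_space ((UNIV :: ((int ^ 'd) \<times> nat) set) \<times> ?L) = count_space UNIV \<Otimes>\<^sub>M count_space ?L"
    by (rule pair_measure_countable[symmetric]) (rule countableI_type)+
  also have "(\<integral>\<^sup>+p. chain_weight g s x ((\<lambda>(a, ws). a # ws) p) \<partial>(count_space UNIV \<Otimes>\<^sub>M count_space ?L)) =
    (\<integral>\<^sup>+a. \<integral>\<^sup>+ws. chain_weight g s x (a # ws) \<partial>count_space ?L \<partial>count_space UNIV)"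
    by (subst sigma_finite_measure.nn_integral_fst[symmetric])
      (auto simp: pair_measure_countable intro!: sigma_finite_measure_count_space_countable)
  also have "\<dots> = (\<integral>\<^sup>+a. (\<lambda>(v, j). g j * (ennreal (exp (- s * vnorm (v - x))) * ?q)) a \<partial>count_space UNIV)"
    by (intro nn_integral_cong) (auto simp: nn_integral_cmult Suc.IH mult.assoc)
  also have "\<dots> = (\<integral>\<^sup>+v. \<integral>\<^sup>+j. g j * (ennreal (exp (- s * vnorm (v - x))) * ?q) \<partial>count_space UNIV \<partial>count_space UNIV)"
    by (subst nn_integral_fst_count_space[symmetric]) simp
  also have "\<dots> = (\<Sum>j. g j) * (?E * ?q)"
    using E by (simp add: nn_integral_cmult nn_integral_multc nn_integral_count_space_nat)
  finally show ?case by (simp add: mult_ac)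
qed

text \<open>The union bound as an integral over the index, the form in which the sum over chains is
  evaluated.\<close>

lemma emeasure_UN_le_nn_integral:
  assumes "countable I" and sets: "\<And>i. i \<in> I \<Longrightarrow> X i \<in> sets M"
  shows "emeasure M (\<Union>i\<in>I. X i) \<le> (\<integral>\<^sup>+i. emeasure M (X i) \<partial>count_space I)"
proof -
  have "(\<Union>i\<in>I. X i) \<in> sets M" using assms by (intro sets.countable_UN') auto
  then have "emeasure M (\<Union>i\<in>I. X i) = (\<integral>\<^sup>+x. indicator (\<Union>i\<in>I. X i) x \<partial>M)" by simp
  also have "\<dots> \<le> (\<integral>\<^sup>+x. \<integral>\<^sup>+i. indicator (X i) x \<partial>count_space I \<partial>M)"
  proof (intro nn_integral_mono)
    fix x
    show "(indicator (\<Union>i\<in>I. X i) x :: ennreal) \<le> (\<integral>\<^sup>+i. indicator (X i) x \<partial>count_space I)"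
    proof (cases "x \<in> (\<Union>i\<in>I. X i)")
      case True
      then obtain i where i: "i \<in> I" "x \<in> X i" by blast
      then have "(indicator (\<Union>i\<in>I. X i) x :: ennreal) = indicator (X i) x" by (auto simp: indicator_def)
      also have "\<dots> \<le> (\<integral>\<^sup>+i. indicator (X i) x \<partial>count_space I)"
        using i(1) by (rule nn_integral_ge_point)
      finally show ?thesis .
    qed simp
  qed
  also have "\<dots> = (\<integral>\<^sup>+i. \<integral>\<^sup>+x. indicator (X i) x \<partial>M \<partial>count_space I)"
    using assms by (intro nn_integral_count_space_nn_integral) auto
  also have "\<dots> = (\<integral>\<^sup>+i. emeasure M (X i) \<partial>count_space I)"
    using sets by (intro nn_integral_cong) simp
  finally show ?thesis .
qed

text \<open>
  The trajectory indices \<open>j\<close> are part of the chain, so that, for a fixed chain, the event is a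
  measurable rectangle in the product space.
\<close>

definition dense_chain :: "nat \<Rightarrow> real \<Rightarrow> real \<Rightarrow> nat \<Rightarrow> (int ^ 'd) config set" where
  "dense_chain l r s n = {\<omega>. \<exists>ws. length ws = n \<and> distinct (map fst ws) \<and>
     s * path_length 0 (map fst ws) < real n \<and>
     (\<forall>(v, j)\<in>set ws. j < fst \<omega> v \<and> wanders l r v (snd \<omega> (v, j)))}"

lemma sets_dense_chain: "dense_chain l r s n \<in> sets (frog_model Q lam)"
  unfolding dense_chain_def by (intro sets_frog_pred) (measurable; simp add: split_def)

lemma prod_list_mult_le:
  fixes f :: "'a \<Rightarrow> ennreal"
  assumes "\<And>v. f v \<le> p"
  shows "(\<Prod>(v, j)\<leftarrow>ws. g j * f v) \<le> p ^ length ws * (\<Prod>(v, j)\<leftarrow>ws. g j)"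
proof (induction ws)
  case (Cons w ws)
  have "g (snd w) * f (fst w) * (\<Prod>(v, j)\<leftarrow>ws. g j * f v) \<le> g (snd w) * p * (p ^ length ws * (\<Prod>(v, j)\<leftarrow>ws. g j))"
    using Cons assms by (intro mult_mono) auto
  then show ?case by (simp add: split_def mult_ac)
qed simp

text \<open>An admissible chain has probability at most \<open>p ^ n\<close> times its Poisson
  tails. Once the exponential weight has replaced the length constraint, the sum is extended to all
  lists of length \<open>n\<close> and factorises into the cost of a single vertex.\<close>

lemma emeasure_dense_chain_le:
  fixes Q :: "int ^ 'd \<Rightarrow> (int ^ 'd) pmf"
  assumes p: "\<And>v. emeasure (walk_law Q v) {X. wanders l r v X} \<le> p"
  shows "emeasure (frog_model Q lam) (dense_chain l r s n) \<le>
    (ennreal (exp 1) * p * ((\<Sum>j. emeasure (measure_pmf (poisson_pmf lam)) {n. j < n}) *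
      (\<integral>\<^sup>+u. ennreal (exp (- s * vnorm (u :: int ^ 'd))) \<partial>count_space UNIV))) ^ n"
proof -
  let ?M = "frog_model Q lam"
  let ?L = "{ws :: ((int ^ 'd) \<times> nat) list. length ws = n}"
  let ?g = "\<lambda>j. emeasure (measure_pmf (poisson_pmf lam)) {n. j < n}"
  define H where "H ws = (if distinct (map fst ws) \<and> s * path_length 0 (map fst ws) < real n
    then {\<omega>. \<forall>(v, j)\<in>set ws. j < fst \<omega> v \<and> wanders l r v (snd \<omega> (v, j))} else {})"
    for ws :: "((int ^ 'd) \<times> nat) list"
  have H_sets: "H ws \<in> sets ?M" for ws
    unfolding H_def by (auto intro!: sets_frog_pred simp: split_def)
  have H_le: "emeasure ?M (H ws) \<le> (ennreal (exp 1) * p) ^ n * chain_weight ?g s 0 ws" if "ws \<in> ?L" for ws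
  proof (cases "distinct (map fst ws) \<and> s * path_length 0 (map fst ws) < real n")
    case True
    \<comment> \<open>exponential Chernoff bound for the number of short chains\<close>
    have one: "1 \<le> ennreal (exp 1) ^ n * ennreal (exp (- s * path_length 0 (map fst ws)))"
      using True by (simp add: ennreal_power flip: ennreal_mult exp_add exp_of_nat_mult ennreal_1)
    have "emeasure ?M (H ws) = (\<Prod>(v, j)\<leftarrow>ws. ?g j * emeasure (walk_law Q v) {X. wanders l r v X})"
      unfolding H_def using True by (simp add: emeasure_frog_chain)
    also have "\<dots> \<le> p ^ n * (\<Prod>(v, j)\<leftarrow>ws. ?g j)"
      using prod_list_mult_le[of "\<lambda>v. emeasure (walk_law Q v) {X. wanders l r v X}" p ?g ws, OF p] that by simp
    also have "\<dots> = p ^ n * (\<Prod>(v, j)\<leftarrow>ws. ?g j) * 1" by simp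
    also have "\<dots> \<le> p ^ n * (\<Prod>(v, j)\<leftarrow>ws. ?g j) * (ennreal (exp 1) ^ n * ennreal (exp (- s * path_length 0 (map fst ws))))"
      using one by (intro mult_left_mono) auto
    also have "\<dots> = (ennreal (exp 1) * p) ^ n * chain_weight ?g s 0 ws"
      by (simp only: chain_weight_eq power_mult_distrib mult_ac)
    finally show ?thesis .
  qed (simp only: H_def if_False emeasure_empty zero_le)
  have "dense_chain l r s n = (\<Union>ws\<in>?L. H ws)"
    by (auto simp: dense_chain_def H_def)
  then have "emeasure ?M (dense_chain l r s n) \<le> (\<integral>\<^sup>+ws. emeasure ?M (H ws) \<partial>count_space ?L)"
    using emeasure_UN_le_nn_integral[of ?L H ?M] H_sets by (simp only: countableI_type)
  also have "\<dots> \<le> (\<integral>\<^sup>+ws. (ennreal (exp 1) * p) ^ n * chain_weight ?g s 0 ws \<partial>count_space ?L)"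
    using H_le by (intro nn_integral_mono) (simp only: space_count_space)
  also have "\<dots> = (ennreal (exp 1) * p) ^ n * (\<integral>\<^sup>+ws. chain_weight ?g s 0 ws \<partial>count_space ?L)"
    by (intro nn_integral_cmult) simp
  finally show ?thesis unfolding nn_integral_chain_weight by (simp only: power_mult_distrib)
qed

text \<open>At scale \<open>2 ^ k\<close> a vertex of a chain costs at most \<open>D * x ^ k\<close>
  with \<open>x < 1\<close>. Geometric series over the size of the chain and over
  \<open>k \<ge> k0\<close> make the total small.\<close>

lemma dense_chain_union_small:
  fixes Q :: "int ^ 'd \<Rightarrow> (int ^ 'd) pmf"
  assumes "heavy_tailed \<alpha> Q" and \<alpha>: "real CARD('d) < \<alpha>" and "0 < lam" "1 \<le> l"
  obtains \<beta> where "1 < \<beta>" and "\<And>e. 0 < e \<Longrightarrow> \<forall>\<^sub>F k0 in sequentially.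
    emeasure (frog_model Q lam) (\<Union>i n. dense_chain l (2 ^ (k0 + i)) (2 powr - (\<beta> * real (k0 + i))) (Suc n)) \<le> ennreal e"
proof -
  let ?d = "real CARD('d)"
  let ?M = "frog_model Q lam"
  \<comment> \<open>The exponents \<open>b\<close>, \<open>\<beta> * b\<close>, \<open>a\<close>,
    \<alpha> are placed above the dimension with equal gaps \<eta>. The lattice sum needs
    \<open>b > d\<close>, the range tail needs \<open>a < \<alpha>\<close>, and
    \<open>a - \<beta> * b = \<eta>\<close> is the decay rate in \<open>k\<close>.\<close>
  define \<eta> where "\<eta> = (\<alpha> - ?d) / 4"
  define a where "a = ?d + 3 * \<eta>"
  define b where "b = ?d + \<eta>"
  define \<beta> where "\<beta> = (?d + 2 * \<eta>) / b"
  have d: "?d > 0" by simp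
  have \<eta>: "\<eta> > 0" using \<alpha> by (simp add: \<eta>_def)
  have ab: "?d < b" "a < \<alpha>" "0 < a" "\<beta> > 1" "\<beta> * b = ?d + 2 * \<eta>"
    using \<eta> d by (auto simp: a_def b_def \<beta>_def \<eta>_def field_simps)
  obtain C1 where C1: "C1 > 0" "\<And>s. 0 < s \<Longrightarrow> s \<le> 1 \<Longrightarrow>
    (\<integral>\<^sup>+u. ennreal (exp (- s * vnorm (u :: int ^ 'd))) \<partial>count_space UNIV) \<le> ennreal (C1 * s powr - b)"
    using nn_integral_exp_vnorm_le[OF ab(1)] by blast
  obtain C2 where C2: "C2 > 0" "\<And>v r. real l \<le> r \<Longrightarrow>
    emeasure (walk_law Q v) {X. wanders l r v X} \<le> ennreal (C2 * r powr - a)"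
    using emeasure_wanders_le[OF assms(1) ab(2,3) assms(4)] by blast
  obtain G where G: "0 \<le> G" "(\<Sum>j. emeasure (measure_pmf (poisson_pmf lam)) {n. j < n}) = ennreal G"
    using poisson_tail_sum_finite[OF assms(3)]
    by (cases "\<Sum>j. emeasure (measure_pmf (poisson_pmf lam)) {n. j < n}") auto
  define D where "D = exp 1 * C2 * (G * C1)"
  define x where "x = 2 powr - \<eta>"
  have D: "D \<ge> 0" using C1 C2 G by (simp add: D_def)
  have x: "0 < x" "x < 1" using \<eta> by (auto simp: x_def powr_less_one)
  \<comment> \<open>\<open>Suc n\<close> leaves out the empty chain, for which the zeroth power
    would only give the bound 1.\<close>
  let ?A = "\<lambda>k n. dense_chain l (2 ^ k) (2 powr - (\<beta> * real k)) (Suc n) :: (int ^ 'd) config set"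
  have A: "emeasure ?M (?A k n) \<le> ennreal ((D * x ^ k) ^ Suc n)" if k: "l \<le> k" for k n
  proof -
    let ?s = "2 powr - (\<beta> * real k)"
    have s: "0 < ?s" "?s \<le> 1" using ab powr_mono[of "- (\<beta> * real k)" 0 2] by simp_all
    have "real l \<le> 2 ^ k" using k of_nat_less_two_power[of k] by (meson less_imp_le of_nat_mono order_trans)
    then have "emeasure ?M (?A k n) \<le>
      (ennreal (exp 1) * ennreal (C2 * (2 ^ k) powr - a) * (ennreal G *
      (\<integral>\<^sup>+u. ennreal (exp (- ?s * vnorm (u :: int ^ 'd))) \<partial>count_space UNIV))) ^ Suc n"
      using emeasure_dense_chain_le[of Q l "2 ^ k" "ennreal (C2 * (2 ^ k) powr - a)" lam ?s "Suc n", OF C2(2)]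
      by (simp only: G)
    also have "\<dots> \<le> (ennreal (exp 1) * ennreal (C2 * (2 ^ k) powr - a) * (ennreal G * ennreal (C1 * ?s powr - b))) ^ Suc n"
      using s by (intro power_mono mult_left_mono C1(2)) auto
    also have "\<dots> = ennreal ((exp 1 * (C2 * (2 ^ k) powr - a) * (G * (C1 * ?s powr - b))) ^ Suc n)"
      using C1(1) C2(1) G(1) by (simp only: ennreal_mult[symmetric] ennreal_power mult_nonneg_nonneg less_imp_le powr_ge_zero exp_ge_zero)
    also have "exp 1 * (C2 * (2 ^ k) powr - a) * (G * (C1 * ?s powr - b)) = D * ((2 ^ k) powr - a * ?s powr - b)"
      by (simp add: D_def)
    also have "(2 ^ k) powr - a * ?s powr - b = 2 powr (- a * real k + \<beta> * b * real k)"
      by (simp add: powr_powr powr_realpow[symmetric] mult_ac flip: powr_add)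
    also have "- a * real k + \<beta> * b * real k = - \<eta> * real k"
      unfolding ab(5) by (simp add: a_def algebra_simps)
    also have "2 powr (- \<eta> * real k) = x ^ k"
      by (simp add: x_def powr_powr flip: powr_realpow)
    finally show ?thesis .
  qed
  have bound: "emeasure ?M (\<Union>i n. ?A (k0 + i) n) \<le> ennreal (2 * D * x ^ k0 / (1 - x))"
    if k0: "l \<le> k0" "D * x ^ k0 \<le> 1 / 2" for k0
  proof -
    have "emeasure ?M (\<Union>i n. ?A (k0 + i) n) \<le> (\<Sum>i. emeasure ?M (\<Union>n. ?A (k0 + i) n))"
      by (intro emeasure_subadditive_countably) (auto intro!: sets_dense_chain)
    also have "\<dots> \<le> (\<Sum>i. ennreal (2 * D * x ^ k0 * x ^ i))"
    proof (intro suminf_le allI)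
      fix i
      \<comment> \<open>\<open>y\<close> is the cost per vertex at scale \<open>k0 + i\<close>;
        \<open>y \<le> 1 / 2\<close> bounds the series over chain sizes by
        \<open>2 * y\<close>.\<close>
      define y where "y = D * x ^ (k0 + i)"
      have "y \<le> D * x ^ k0" unfolding y_def using x D by (intro mult_left_mono power_decreasing) auto
      with k0 D x have y: "0 \<le> y" "y \<le> 1 / 2" by (auto simp: y_def)
      have "emeasure ?M (\<Union>n. ?A (k0 + i) n) \<le> (\<Sum>n. emeasure ?M (?A (k0 + i) n))"
        by (intro emeasure_subadditive_countably) (auto intro!: sets_dense_chain)
      also have "\<dots> \<le> (\<Sum>n. ennreal (y * y ^ n))"
        using A[of "k0 + i"] k0 by (intro suminf_le) (auto simp: y_def)
      also have "\<dots> = ennreal (y / (1 - y))"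
        using y by (subst suminf_ennreal2) (auto simp: suminf_geometric suminf_mult intro!: summable_mult summable_geometric)
      also have "\<dots> \<le> ennreal (2 * y)"
      proof (rule ennreal_leI)
        have "y * 1 \<le> y * (2 * (1 - y))" using y by (intro mult_left_mono) auto
        then show "y / (1 - y) \<le> 2 * y" using y by (simp add: pos_divide_le_eq algebra_simps)
      qed
      finally show "emeasure ?M (\<Union>n. ?A (k0 + i) n) \<le> ennreal (2 * D * x ^ k0 * x ^ i)"
        by (simp add: y_def power_add mult_ac)
    qed auto
    also have "\<dots> = ennreal (2 * D * x ^ k0 / (1 - x))"
      using x D by (subst suminf_ennreal2) (auto simp: suminf_geometric suminf_mult intro!: summable_mult summable_geometric)
    finally show ?thesis .
  qed
  have lim: "(\<lambda>k. x ^ k) \<longlonglongrightarrow> 0" using x by (intro LIMSEQ_power_zero) simp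
  have "\<forall>\<^sub>F k0 in sequentially. emeasure ?M (\<Union>i n. ?A (k0 + i) n) \<le> ennreal e" if e: "0 < e" for e
  proof -
    have "(\<lambda>k. D * x ^ k) \<longlonglongrightarrow> D * 0" by (intro tendsto_intros lim)
    then have "\<forall>\<^sub>F k in sequentially. D * x ^ k < 1 / 2" by (intro order_tendstoD(2)) auto
    moreover have "(\<lambda>k. 2 * D * x ^ k / (1 - x)) \<longlonglongrightarrow> 2 * D * 0 / (1 - x)"
      using x by (intro tendsto_intros lim) auto
    then have "\<forall>\<^sub>F k in sequentially. 2 * D * x ^ k / (1 - x) < e" using e by (intro order_tendstoD(2)) auto
    moreover have "\<forall>\<^sub>F k in sequentially. l \<le> k" by (rule eventually_ge_at_top)
    ultimately show ?thesis
      by eventually_elim (use bound in \<open>meson ennreal_leI less_imp_le order_trans\<close>)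
  qed
  with ab(4) show ?thesis by (rule that)
qed

section \<open>Paths with few long jumps\<close>

lemma path_length_triangle: "path_length x ys \<le> vnorm (y - x) + path_length y ys"
proof (cases ys)
  case (Cons z zs)
  then show ?thesis using vnorm_triangle_diff[of z x y] by simp
qed (simp add: vnorm_nonneg)

text \<open>Skipping vertices cannot lengthen a path, by the triangle inequality. Thus the departure
  points of the long jumps form a chain no longer than the path itself.\<close>

lemma path_length_filter_le: "path_length x (map p (filter P ns)) \<le> path_length x (map p ns)"
proof (induction ns arbitrary: x)
  case (Cons n ns)
  show ?case
    using Cons.IH[of "p n"] path_length_triangle[of x "map p (filter P ns)" "p n"] by simp
qed simp

lemma path_length_append: "path_length x (ys @ [y]) = path_length x ys + vnorm (y - last (x # ys))"
  by (induction ys arbitrary: x) auto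

lemma path_length_map_upt:
  "path_length (p 0) (map p [0..<Suc m]) = (\<Sum>i<m. vnorm (p (Suc i) - p i))"
proof (induction m)
  case (Suc m)
  have "path_length (p 0) (map p [0..<Suc (Suc m)]) = path_length (p 0) (map p [0..<Suc m] @ [p (Suc m)])"
    by simp
  also have "\<dots> = path_length (p 0) (map p [0..<Suc m]) + vnorm (p (Suc m) - p m)"
    by (subst path_length_append) simp
  finally show ?case unfolding Suc by simp
qed simp

lemma vnorm_telescope_le: "vnorm (p m - p 0) \<le> (\<Sum>i<m. vnorm (p (Suc i) - p i))"
proof (induction m)
  case (Suc m)
  then show ?case using vnorm_triangle_diff[of "p (Suc m)" "p 0" "p m"] by simp
qed simp

text \<open>If \<open>x \<ge> 2 ^ k\<close>, the highest layer below \<open>x\<close> alone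
  contributes more than \<open>x\<close>; otherwise the term \<open>2 ^ k\<close> suffices.\<close>

lemma dyadic_layer_bound:
  fixes x :: real
  assumes "x < 2 ^ (k + n)"
  shows "x \<le> 2 ^ k + (\<Sum>a<n. 2 ^ (k + a + 1) * of_bool (2 ^ (k + a) \<le> x))"
  using assms
proof (induction n)
  case (Suc n)
  show ?case
  proof (cases "x < 2 ^ (k + n)")
    case True
    then show ?thesis using Suc.IH by simp
  next
    case False
    have "0 \<le> (\<Sum>a<n. 2 ^ (k + a + 1) * of_bool (2 ^ (k + a) \<le> x) :: real)"
      by (intro sum_nonneg) auto
    moreover have "(0::real) \<le> 2 ^ k" by simp
    moreover have "2 ^ (k + n + 1) * of_bool (2 ^ (k + n) \<le> x) > x" using False Suc.prems by simp
    ultimately show ?thesis unfolding sum.lessThan_Suc by linarith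
  qed
qed simp

text \<open>The deterministic half of the argument: without dense chains, the number of jumps of
  size at least \<open>2 ^ (k + i)\<close> is at most \<open>s i * L\<close>. Injectivity is asked
  for on \<open>{..<m}\<close> because chains consist of departure points.\<close>

lemma path_reach_le:
  fixes \<omega> :: "(int ^ 'd) config"
  assumes sparse: "\<And>i n. \<omega> \<notin> dense_chain l (2 ^ (k + i)) (s i) (Suc n)"
    and s_nonneg: "\<And>i. 0 \<le> s i"
    and s_sum: "\<And>n. (\<Sum>i<n. 2 ^ (k + i + 1) * s i) \<le> 1 / 2"
    and p0: "p 0 = 0" and inj: "inj_on p {..<m}"
    and step: "\<And>i. i < m \<Longrightarrow> \<exists>j<fst \<omega> (p i). \<exists>n\<le>l. snd \<omega> (p i, j) n = p (Suc i)"
  shows "vnorm (p m) \<le> 2 ^ (k + 1) * real m"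
proof -
  obtain J where J: "\<And>i. i < m \<Longrightarrow> J i < fst \<omega> (p i) \<and> (\<exists>n\<le>l. snd \<omega> (p i, J i) n = p (Suc i))"
    using step by metis
  define D where "D i = vnorm (p (Suc i) - p i)" for i
  define L where "L = (\<Sum>i<m. D i)"
  have D: "0 \<le> D i" for i by (simp add: D_def vnorm_nonneg)
  then have L: "0 \<le> L" unfolding L_def by (intro sum_nonneg) auto
  define N where "N r = card {i \<in> {..<m}. r \<le> D i}" for r
  have N: "real (N (2 ^ (k + i))) \<le> s i * L" for i
  proof (cases "N (2 ^ (k + i))")
    \<comment> \<open>Sparsity speaks of nonempty chains, so a scale without long jumps is treated
      apart.\<close>
    case 0
    then show ?thesis using L s_nonneg by simp
  next
    case (Suc n)
    define r :: real where "r = 2 ^ (k + i)"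
    \<comment> \<open>The departures of the long jumps in path order; in \<open>ws\<close> each is
      paired with a particle that makes the jump.\<close>
    define ns where "ns = filter (\<lambda>i. r \<le> D i) [0..<m]"
    define ws where "ws = map (\<lambda>i. (p i, J i)) ns"
    have ns: "set ns \<subseteq> {..<m}" "distinct ns" by (auto simp: ns_def)
    have fst_ws: "map fst ws = map p ns" by (simp add: ws_def)
    have "length ws = card (set ns)" using ns by (simp add: ws_def distinct_card)
    also have "set ns = {i \<in> {..<m}. r \<le> D i}" by (auto simp: ns_def)
    finally have len: "length ws = Suc n" using Suc by (simp add: N_def r_def)
    have "distinct (map fst ws)"
      unfolding fst_ws distinct_map using ns inj by (auto intro: inj_on_subset)
    moreover have "j < fst \<omega> v \<and> wanders l r v (snd \<omega> (v, j))" if "(v, j) \<in> set ws" for v j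
    proof -
      from that obtain i where i: "i < m" "r \<le> D i" "v = p i" "j = J i" by (auto simp: ws_def ns_def)
      then show ?thesis using J[OF i(1)] by (auto simp: wanders_def D_def)
    qed
    ultimately have "\<not> s i * path_length 0 (map fst ws) < real (Suc n)"
      using sparse[of i n] len unfolding dense_chain_def r_def by blast
    moreover have "path_length 0 (map fst ws) \<le> L"
    proof (cases m)
      case 0
      then show ?thesis using L by (simp add: ws_def ns_def)
    next
      case (Suc m')
      \<comment> \<open>The last departure is \<open>p m'\<close>, so the final jump of the path
        does not enter.\<close>
      have "path_length 0 (map fst ws) \<le> path_length (p 0) (map p [0..<m])"
        unfolding fst_ws ns_def p0 by (rule path_length_filter_le)
      also have "\<dots> = (\<Sum>i<m'. D i)" unfolding Suc path_length_map_upt D_def ..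
      also have "\<dots> \<le> L" unfolding L_def Suc using D by simp
      finally show ?thesis .
    qed
    ultimately show ?thesis
      unfolding Suc using mult_left_mono[OF _ s_nonneg[of i], of "path_length 0 (map fst ws)" L] by linarith
  qed
  \<comment> \<open>No jump exceeds \<open>L\<close>, so finitely many layers suffice.\<close>
  obtain n where n: "L < 2 ^ n" using real_arch_pow[of 2 L] by auto
  have layer: "D i \<le> 2 ^ k + (\<Sum>a<n. 2 ^ (k + a + 1) * of_bool (2 ^ (k + a) \<le> D i))" if "i < m" for i
  proof (rule dyadic_layer_bound)
    have "D i \<le> L" unfolding L_def by (rule member_le_sum) (use that D in auto)
    also have "\<dots> < 2 ^ n" by (rule n)
    also have "\<dots> \<le> 2 ^ (k + n)" by (intro power_increasing) auto
    finally show "D i < 2 ^ (k + n)" .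
  qed
  have "L \<le> (\<Sum>i<m. 2 ^ k + (\<Sum>a<n. 2 ^ (k + a + 1) * of_bool (2 ^ (k + a) \<le> D i)))"
    unfolding L_def using layer by (intro sum_mono) auto
  \<comment> \<open>Exchanging the sums turns the layers into the counts \<open>N\<close>. The
    resulting \<open>L / 2\<close> is absorbed on the left, which doubles
    \<open>2 ^ k\<close>.\<close>
  also have "\<dots> = real m * 2 ^ k + (\<Sum>a<n. \<Sum>i<m. 2 ^ (k + a + 1) * of_bool (2 ^ (k + a) \<le> D i))"
    by (simp only: sum.distrib sum_constant card_lessThan) (subst sum.swap, rule refl)
  also have "(\<Sum>a<n. \<Sum>i<m. 2 ^ (k + a + 1) * of_bool (2 ^ (k + a) \<le> D i)) = (\<Sum>a<n. 2 ^ (k + a + 1) * real (N (2 ^ (k + a))))"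
    by (simp only: sum_distrib_left[symmetric] N_def) (simp add: Int_def)
  also have "\<dots> \<le> (\<Sum>a<n. 2 ^ (k + a + 1) * (s a * L))"
    using N by (intro sum_mono mult_left_mono) auto
  also have "\<dots> = (\<Sum>a<n. 2 ^ (k + a + 1) * s a) * L"
    by (simp only: sum_distrib_right mult.assoc)
  also have "\<dots> \<le> 1 / 2 * L" by (intro mult_right_mono s_sum L)
  finally have "L \<le> 2 ^ (k + 1) * real m" by (simp add: field_simps)
  moreover have "vnorm (p m) \<le> L" using vnorm_telescope_le[of p m] by (simp add: p0 L_def D_def)
  ultimately show ?thesis by linarith
qed

section \<open>Activation along self-avoiding paths\<close>

lemma hit_time_finite:
  assumes "hit_time l \<omega> v u < \<infinity>"
  shows "\<exists>j<fst \<omega> v. \<exists>n\<le>l. snd \<omega> (v, j) n = u"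
proof (rule ccontr)
  assume "\<not> ?thesis"
  then have "{k. k \<le> l \<and> (\<exists>j<fst \<omega> v. snd \<omega> (v, j) k = u)} = {}" by blast
  then have "hit_time l \<omega> v u = \<infinity>"
    unfolding hit_time_def by (simp only: image_empty Inf_empty top_enat_def)
  with assms show False by simp
qed

text \<open>A particle that starts at \<open>v\<close> needs at least one step to be elsewhere. The
  start is an explicit assumption since it holds only almost surely.\<close>

lemma hit_time_ge_one:
  assumes "\<And>j. j < fst \<omega> v \<Longrightarrow> snd \<omega> (v, j) 0 = v" and "u \<noteq> v"
  shows "1 \<le> hit_time l \<omega> v u"
  unfolding hit_time_def
proof (rule INF_greatest)
  fix k assume "k \<in> {k. k \<le> l \<and> (\<exists>j<fst \<omega> v. snd \<omega> (v, j) k = u)}"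
  then have "k \<noteq> 0" using assms by (cases k) auto
  then show "1 \<le> enat k" by (simp add: one_enat_def)
qed

lemma Inf_enat_mem: "A \<noteq> {} \<Longrightarrow> Inf A \<in> (A :: enat set)"
  using wellorder_InfI by blast

text \<open>The total time is only bounded by \<open>T\<close>, so that the predicate survives the
  removal of loops.\<close>

definition activation_path :: "nat \<Rightarrow> 'v config \<Rightarrow> 'v \<Rightarrow> 'v \<Rightarrow> enat \<Rightarrow> nat \<Rightarrow> (nat \<Rightarrow> 'v) \<Rightarrow> bool" where
  "activation_path l \<omega> w u T m p \<longleftrightarrow> p 0 = w \<and> p m = u \<and>
     (\<forall>i<m. hit_time l \<omega> (p i) (p (Suc i)) < \<infinity>) \<and> (\<Sum>i<m. hit_time l \<omega> (p i) (p (Suc i))) \<le> T"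

text \<open>A nonempty set of extended naturals has a least element, so a finite infimum is attained
  by an actual path.\<close>

lemma activation_time_le_iff:
  "activation_time l \<omega> w u \<le> enat n \<longleftrightarrow> (\<exists>m p. activation_path l \<omega> w u (enat n) m p)"
proof
  let ?S = "{\<Sum>i<m. hit_time l \<omega> (p i) (p (Suc i)) | m p.
     p 0 = w \<and> p m = u \<and> (\<forall>i<m. hit_time l \<omega> (p i) (p (Suc i)) < \<infinity>)}"
  assume le: "activation_time l \<omega> w u \<le> enat n"
  have "?S \<noteq> {}"
  proof
    assume "?S = {}"
    then have "activation_time l \<omega> w u = \<infinity>"
      unfolding activation_time_def by (simp only: Inf_empty top_enat_def)
    with le show False by simp
  qed
  then have "activation_time l \<omega> w u \<in> ?S"
    unfolding activation_time_def by (rule Inf_enat_mem)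
  then obtain m p where "activation_time l \<omega> w u = (\<Sum>i<m. hit_time l \<omega> (p i) (p (Suc i)))"
    "p 0 = w" "p m = u" "\<forall>i<m. hit_time l \<omega> (p i) (p (Suc i)) < \<infinity>" by blast
  with le have "activation_path l \<omega> w u (enat n) m p"
    unfolding activation_path_def by simp
  then show "\<exists>m p. activation_path l \<omega> w u (enat n) m p" by blast
next
  assume "\<exists>m p. activation_path l \<omega> w u (enat n) m p"
  then obtain m p where p: "activation_path l \<omega> w u (enat n) m p" by blast
  then have "activation_time l \<omega> w u \<le> (\<Sum>i<m. hit_time l \<omega> (p i) (p (Suc i)))"
    unfolding activation_path_def activation_time_def by (intro Inf_lower) blast
  also have "\<dots> \<le> enat n" using p by (simp only: activation_path_def)
  finally show "activation_time l \<omega> w u \<le> enat n" .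
qed

text \<open>Cutting out a loop keeps the endpoints, and the surviving steps are distinct steps of
  the old path, so the total time does not grow.\<close>

lemma activation_path_splice:
  assumes path: "activation_path l \<omega> w u T m p" and ij: "i < j" "j \<le> m" "p i = p j"
  shows "activation_path l \<omega> w u T (m - (j - i)) (\<lambda>a. if a < i then p a else p (a + (j - i)))"
proof -
  let ?q = "\<lambda>a. if a < i then p a else p (a + (j - i))"
  let ?m = "m - (j - i)"
  let ?h = "\<lambda>i. hit_time l \<omega> (p i) (p (Suc i))"
  define \<phi> where "\<phi> a = (if a < i then a else a + (j - i))" for a
  have eq: "hit_time l \<omega> (?q a) (?q (Suc a)) = ?h (\<phi> a)" for a
  \<comment> \<open>The step into the cut now ends at \<open>p j\<close>, which is
    \<open>p i\<close>; all other steps are old steps with index given by \<phi>.\<close>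
  proof (cases "Suc a = i")
    case True
    then have "?q (Suc a) = p (Suc a)" using ij by simp
    then show ?thesis using True by (simp add: \<phi>_def)
  qed (auto simp: \<phi>_def)
  have \<phi>: "\<phi> a < m" if "a < ?m" for a using that ij by (auto simp: \<phi>_def)
  have inj: "inj_on \<phi> {..<?m}" by (auto simp: inj_on_def \<phi>_def split: if_splits)
  have "(\<Sum>a<?m. hit_time l \<omega> (?q a) (?q (Suc a))) = (\<Sum>a<?m. ?h (\<phi> a))" by (simp only: eq)
  also have "\<dots> = (\<Sum>b\<in>\<phi> ` {..<?m}. ?h b)" using inj by (simp add: sum.reindex)
  also have "\<dots> \<le> (\<Sum>b<m. ?h b)" using \<phi> by (intro sum_mono2) auto
  also have "\<dots> \<le> T" using path by (simp add: activation_path_def)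
  finally have sum: "(\<Sum>a<?m. hit_time l \<omega> (?q a) (?q (Suc a))) \<le> T" .
  have "?q 0 = w" using path ij by (cases "i = 0") (auto simp: activation_path_def)
  moreover have "?q ?m = u" using path ij by (auto simp: activation_path_def)
  moreover have "\<forall>a<?m. hit_time l \<omega> (?q a) (?q (Suc a)) < \<infinity>"
    unfolding eq using \<phi> path by (auto simp: activation_path_def)
  ultimately show ?thesis using sum unfolding activation_path_def by blast
qed

text \<open>A path with the fewest jumps repeats no vertex, since a loop could be cut out. So each
  of its jumps takes time at least 1, which bounds their number by \<open>t\<close>.\<close>

lemma activated_obtain_path:
  assumes u: "u \<in> activated l \<omega> t"
    and start: "\<And>v j. j < fst \<omega> v \<Longrightarrow> snd \<omega> (v, j) 0 = v"
  obtains m p where "p 0 = 0" "p m = u" "inj_on p {..<m}" "real m \<le> t"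
    "\<And>i. i < m \<Longrightarrow> \<exists>j<fst \<omega> (p i). \<exists>n\<le>l. snd \<omega> (p i, j) n = p (Suc i)"
proof -
  obtain T where T: "activation_time l \<omega> 0 u = enat T" "real T \<le> t"
    using u unfolding activated_def by (cases "activation_time l \<omega> 0 u") auto
  then have ex: "\<exists>m p. activation_path l \<omega> 0 u (enat T) m p"
    by (simp flip: activation_time_le_iff)
  define m where "m = (LEAST m. \<exists>p. activation_path l \<omega> 0 u (enat T) m p)"
  obtain p where p: "activation_path l \<omega> 0 u (enat T) m p"
    using LeastI_ex[OF ex] unfolding m_def by blast
  have ne: "p i \<noteq> p j" if "i < j" "j \<le> m" for i j
  proof
    assume "p i = p j"
    from activation_path_splice[OF p that this]
    have "m \<le> m - (j - i)" unfolding m_def by (blast intro: Least_le)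
    with that show False by simp
  qed
  have "inj_on p {..<m}"
    using ne by (intro linorder_inj_onI) auto
  moreover have "real m \<le> t"
  proof -
    have "enat m = (\<Sum>i<m. 1)" by (simp add: of_nat_eq_enat)
    also have "\<dots> \<le> (\<Sum>i<m. hit_time l \<omega> (p i) (p (Suc i)))"
      using ne start by (intro sum_mono hit_time_ge_one) (metis Suc_leI lessI lessThan_iff)+
    also have "\<dots> \<le> enat T" using p by (simp add: activation_path_def)
    finally show ?thesis using T by simp
  qed
  moreover have "\<exists>j<fst \<omega> (p i). \<exists>n\<le>l. snd \<omega> (p i, j) n = p (Suc i)" if "i < m" for i
    using p that by (intro hit_time_finite) (auto simp: activation_path_def)
  ultimately show ?thesis using p that unfolding activation_path_def by blast
qed

section \<open>Measurability of activation\<close>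

lemma hit_time_le_iff:
  "hit_time l \<omega> v u \<le> enat k \<longleftrightarrow> (\<exists>i\<le>l. i \<le> k \<and> (\<exists>j<fst \<omega> v. snd \<omega> (v, j) i = u))"
proof
  let ?S = "{k. k \<le> l \<and> (\<exists>j<fst \<omega> v. snd \<omega> (v, j) k = u)}"
  assume le: "hit_time l \<omega> v u \<le> enat k"
  have "?S \<noteq> {}"
    using hit_time_finite[of l \<omega> v u] le by (cases "hit_time l \<omega> v u") auto
  then have "hit_time l \<omega> v u \<in> enat ` ?S"
    unfolding hit_time_def by (intro Inf_enat_mem) blast
  with le show "\<exists>i\<le>l. i \<le> k \<and> (\<exists>j<fst \<omega> v. snd \<omega> (v, j) i = u)" by auto
next
  assume "\<exists>i\<le>l. i \<le> k \<and> (\<exists>j<fst \<omega> v. snd \<omega> (v, j) i = u)"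
  then obtain i where i: "i \<le> l" "i \<le> k" "\<exists>j<fst \<omega> v. snd \<omega> (v, j) i = u" by blast
  then have "hit_time l \<omega> v u \<le> enat i" unfolding hit_time_def by (intro INF_lower) blast
  also have "\<dots> \<le> enat k" using i by simp
  finally show "hit_time l \<omega> v u \<le> enat k" .
qed

lemma sum_enat: "(\<Sum>i\<in>A. enat (f i)) = enat (\<Sum>i\<in>A. f i)"
  by (induction A rule: infinite_finite_induct) (auto simp: zero_enat_def)

text \<open>Lists over a countable type are countable, unlike functions on the naturals, so the
  quantifier over paths becomes a countable union. The entries of \<open>ts\<close> are upper bounds
  for the hitting times.\<close>

lemma activation_time_le_iff_lists:
  "activation_time l \<omega> w u \<le> enat n \<longleftrightarrow> (\<exists>ps ts. length ps = Suc (length ts) \<and> ps ! 0 = w \<and> ps ! length ts = u \<and>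
    sum_list ts \<le> n \<and> (\<forall>i<length ts. hit_time l \<omega> (ps ! i) (ps ! Suc i) \<le> enat (ts ! i)))"
    (is "_ \<longleftrightarrow> ?R")
proof
  assume "activation_time l \<omega> w u \<le> enat n"
  then obtain m p where p: "activation_path l \<omega> w u (enat n) m p" by (auto simp: activation_time_le_iff)
  define h where "h i = the_enat (hit_time l \<omega> (p i) (p (Suc i)))" for i
  have h: "hit_time l \<omega> (p i) (p (Suc i)) = enat (h i)" if "i < m" for i
    using p that by (cases "hit_time l \<omega> (p i) (p (Suc i))") (auto simp: h_def activation_path_def)
  have "(\<Sum>i<m. hit_time l \<omega> (p i) (p (Suc i))) = (\<Sum>i<m. enat (h i))"
    using h by (intro sum.cong) auto
  also have "\<dots> = enat (\<Sum>i<m. h i)" by (rule sum_enat)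
  finally have "(\<Sum>i<m. h i) \<le> n" using p by (simp add: activation_path_def)
  then have "sum_list (map h [0..<m]) \<le> n"
    by (simp add: sum_list_distinct_conv_sum_set atLeast0LessThan)
  moreover have "\<forall>i<m. hit_time l \<omega> (map p [0..<Suc m] ! i) (map p [0..<Suc m] ! Suc i) \<le> enat (map h [0..<m] ! i)"
    using h by (simp add: nth_append del: upt_Suc)
  moreover have "map p [0..<Suc m] ! 0 = w" "map p [0..<Suc m] ! m = u"
    using p by (simp_all add: activation_path_def del: upt_Suc)
  ultimately show ?R
    by (intro exI[of _ "map p [0..<Suc m]"] exI[of _ "map h [0..<m]"]) (simp del: upt_Suc)
next
  assume ?R
  then obtain ps ts where *: "ps ! 0 = w" "ps ! length ts = u" "sum_list ts \<le> n"
    "\<And>i. i < length ts \<Longrightarrow> hit_time l \<omega> (ps ! i) (ps ! Suc i) \<le> enat (ts ! i)" by blast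
  have fin: "hit_time l \<omega> (ps ! i) (ps ! Suc i) < \<infinity>" if "i < length ts" for i
    by (rule le_less_trans[OF *(4)[OF that]]) simp
  have "(\<Sum>i<length ts. hit_time l \<omega> (ps ! i) (ps ! Suc i)) \<le> (\<Sum>i<length ts. enat (ts ! i))"
    using *(4) by (intro sum_mono) auto
  also have "\<dots> = enat (sum_list ts)"
    by (simp add: sum_list_sum_nth atLeast0LessThan sum_enat)
  also have "\<dots> \<le> enat n" using *(3) by simp
  finally have "activation_path l \<omega> w u (enat n) (length ts) (\<lambda>i. ps ! i)"
    unfolding activation_path_def using *(1,2) fin by blast
  then show "activation_time l \<omega> w u \<le> enat n" by (auto simp: activation_time_le_iff)
qed

lemma measurable_activation_time_le [measurable]:
  fixes w u :: "'v :: countable"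
  shows "Measurable.pred (PiM UNIV (\<lambda>_. count_space UNIV) \<Otimes>\<^sub>M PiM UNIV (\<lambda>_. PiM UNIV (\<lambda>_. count_space UNIV)))
    (\<lambda>\<omega>. activation_time l \<omega> w u \<le> enat n)"
  unfolding activation_time_le_iff_lists hit_time_le_iff by measurable

text \<open>Activation times are integers or infinite, so \<open>t\<close> may be rounded
  down.\<close>

lemma activated_eq:
  assumes "0 \<le> t"
  shows "activated l \<omega> t = {u. activation_time l \<omega> 0 u \<le> enat (nat \<lfloor>t\<rfloor>)}"
proof -
  have "ereal_of_enat T \<le> ereal t \<longleftrightarrow> T \<le> enat (nat \<lfloor>t\<rfloor>)" for T
    using assms by (cases T) (auto simp: le_nat_iff le_floor_iff)
  then show ?thesis by (simp add: activated_def)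
qed

text \<open>A countable type has only countably many finite subsets, so the event is a countable
  union over the values of the activated set.\<close>

lemma sets_activated_pred:
  fixes Q :: "'v :: {countable, zero} \<Rightarrow> 'v pmf"
  assumes fin: "\<And>S. P S \<Longrightarrow> finite S"
  shows "{\<omega>. P {u. activation_time l \<omega> (0 :: 'v) u \<le> enat n}} \<in> sets (frog_model Q lam)"
proof -
  let ?A = "\<lambda>\<omega>. {u. activation_time l \<omega> (0 :: 'v) u \<le> enat n}"
  have "{\<omega>. ?A \<omega> = S} \<in> sets (frog_model Q lam)" for S
    unfolding set_eq_iff mem_Collect_eq by (intro sets_frog_pred) measurable
  then have "(\<Union>S\<in>{S. finite S \<and> P S}. {\<omega>. ?A \<omega> = S}) \<in> sets (frog_model Q lam)"
    by (intro sets.countable_UN') (auto intro: countable_subset[OF _ countable_Collect_finite])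
  also have "(\<Union>S\<in>{S. finite S \<and> P S}. {\<omega>. ?A \<omega> = S}) = {\<omega>. P (?A \<omega>)}"
    using fin by auto
  finally show ?thesis .
qed

text \<open>The activated set depends on \<open>L\<close> only through the integer part of
  \<open>c * L\<close>. Grouping \<open>L\<close> by it turns the uncountable intersection into a
  countable one.\<close>

lemma sets_activated_event:
  fixes Q :: "'v :: {countable, zero} \<Rightarrow> 'v pmf"
  assumes "0 < c" and fin: "\<And>S L. 0 < L \<Longrightarrow> R S L \<Longrightarrow> finite S"
  shows "{\<omega>. \<forall>L>0. R (activated l \<omega> (c * L)) L} \<in> sets (frog_model Q lam)"
proof -
  define P where "P n S \<longleftrightarrow> (\<forall>L>0. nat \<lfloor>c * L\<rfloor> = n \<longrightarrow> R S L)" for n S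
  have "{\<omega>. \<forall>L>0. R (activated l \<omega> (c * L)) L} =
    (\<Inter>n. {\<omega>. P n {u. activation_time l \<omega> (0 :: 'v) u \<le> enat n}})"
    using assms by (auto simp: P_def activated_eq)
  moreover have "{\<omega>. P n {u. activation_time l \<omega> (0 :: 'v) u \<le> enat n}} \<in> sets (frog_model Q lam)" for n
  proof (rule sets_activated_pred)
    fix S assume P: "P n S"
    \<comment> \<open>Each group contains a positive \<open>L\<close>, so \<open>P n S\<close> does
      imply finiteness; the summand \<open>1 / 2\<close> keeps \<open>L\<close> positive for
      \<open>n = 0\<close>.\<close>
    define L where "L = (real n + 1 / 2) / c"
    have "0 < L" "nat \<lfloor>c * L\<rfloor> = n" using assms(1) by (auto simp: L_def floor_eq_iff)
    with P have "R S L" by (simp add: P_def)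
    with \<open>0 < L\<close> show "finite S" by (rule fin)
  qed
  ultimately show ?thesis by (simp add: sets.countable_INT)
qed

section \<open>Linear growth\<close>

text \<open>There are countably many particles, each with a null event by the one-entry case of
  \<open>emeasure_frog_chain\<close>.\<close>

lemma emeasure_frog_start:
  fixes Q :: "'v :: countable \<Rightarrow> 'v pmf"
  shows "(\<Union>(v, j). {\<omega>. j < fst \<omega> v \<and> snd \<omega> (v, j) 0 \<noteq> v}) \<in> null_sets (frog_model Q lam)"
proof -
  have "{\<omega>. j < fst \<omega> v \<and> snd \<omega> (v, j) 0 \<noteq> v} \<in> null_sets (frog_model Q lam)" for v j
  proof (rule null_setsI)
    have "Measurable.pred (PiM UNIV (\<lambda>_. count_space UNIV)) (\<lambda>X :: nat \<Rightarrow> 'v. X 0 \<noteq> u)" for u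
      by measurable
    then show "emeasure (frog_model Q lam) {\<omega>. j < fst \<omega> v \<and> snd \<omega> (v, j) 0 \<noteq> v} = 0"
      using emeasure_frog_chain[of "[(v, j)]" "\<lambda>v X. X 0 \<noteq> v" Q lam] by (simp add: emeasure_walk_start)
  qed (intro sets_frog_pred, measurable)
  then show ?thesis by (auto intro!: null_sets_UN)
qed

text \<open>The terms are \<open>2 * y ^ (k + i)\<close> with
  \<open>y = 2 powr (1 - \<beta>)\<close>, and \<open>\<beta> > 1\<close> makes this the tail of a
  convergent geometric series.\<close>

lemma growth_series_small:
  assumes "1 < \<beta>"
  shows "\<forall>\<^sub>F k in sequentially. \<forall>n. (\<Sum>i<n. 2 ^ (k + i + 1) * 2 powr - (\<beta> * real (k + i))) \<le> (1 / 2 :: real)"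
proof -
  define y where "y = 2 powr (1 - \<beta>)"
  have y: "0 < y" "y < 1" using assms by (auto simp: y_def powr_less_one)
  have eq: "2 ^ (k + i + 1) * 2 powr - (\<beta> * real (k + i)) = 2 * y ^ k * y ^ i" for k i
  proof -
    have "2 ^ (k + i) * 2 powr - (\<beta> * real (k + i)) = 2 powr ((1 - \<beta>) * real (k + i))"
      by (simp add: powr_realpow[symmetric] algebra_simps flip: powr_add)
    also have "\<dots> = y ^ (k + i)" unfolding y_def by (simp add: powr_powr flip: powr_realpow)
    finally show ?thesis by (simp add: power_add)
  qed
  have sum_le: "(\<Sum>i<n. 2 * y ^ k * y ^ i) \<le> 2 * y ^ k / (1 - y)" for k n
  proof -
    have "(\<Sum>i<n. y ^ i) \<le> 1 / (1 - y)"
      using sum_le_suminf[of "\<lambda>i. y ^ i" "{..<n}"] y by (simp add: suminf_geometric summable_geometric)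
    then have "2 * y ^ k * (\<Sum>i<n. y ^ i) \<le> 2 * y ^ k * (1 / (1 - y))" using y by (intro mult_left_mono) auto
    then show ?thesis by (simp add: sum_distrib_left)
  qed
  have "(\<lambda>k. 2 * y ^ k / (1 - y)) \<longlonglongrightarrow> 2 * 0 / (1 - y)"
    using y by (intro tendsto_intros LIMSEQ_power_zero) auto
  then have "\<forall>\<^sub>F k in sequentially. 2 * y ^ k / (1 - y) < 1 / 2" by (intro order_tendstoD(2)) auto
  then show ?thesis
    unfolding eq by eventually_elim (use sum_le in \<open>meson less_imp_le order_trans\<close>)
qed

text \<open>Let \<open>r = \<epsilon> / 4 * L\<close>. For \<open>r < 1\<close> the ball is the
  origin and the lower bound on \<open>L\<close> applies. For \<open>r \<ge> 1\<close> its side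
  \<open>2 * r + 1\<close> is at most \<open>3 * r\<close>, and
  \<open>3 / 4 * \<epsilon> < 1\<close> bounds its power by itself.\<close>

lemma small_ball_density:
  fixes S :: "(int ^ 'd) set"
  assumes "0 < \<epsilon>" "\<epsilon> < 1" "0 < L" and S: "S \<subseteq> {u. vnorm u \<le> \<epsilon> / 4 * L}" and L: "1 / \<epsilon> < L ^ CARD('d)"
  shows "real (card S) / L ^ CARD('d) < \<epsilon>"
proof -
  let ?B = "{u :: int ^ 'd. vnorm u \<le> \<epsilon> / 4 * L}"
  have "finite ?B" unfolding vnorm_ball_eq_lattice_box by (rule finite_lattice_box)
  then have card: "real (card S) \<le> real (card ?B)" using S by (simp add: card_mono)
  have "real (card ?B) < \<epsilon> * L ^ CARD('d)"
  proof (cases "\<epsilon> / 4 * L < 1")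
    case True
    then have "?B \<subseteq> {0}" by (auto simp flip: vnorm_less_one_iff)
    then have "card ?B \<le> 1" using card_mono[of "{0 :: int ^ 'd}" ?B] by simp
    then show ?thesis using L assms by (simp add: field_simps)
  next
    case False
    have "real (card ?B) \<le> (2 * (\<epsilon> / 4 * L) + 1) ^ CARD('d)"
      using assms by (intro card_vnorm_ball) auto
    also have "\<dots> \<le> (3 / 4 * \<epsilon> * L) ^ CARD('d)"
      using False assms by (intro power_mono) (simp_all add: field_simps)
    also have "\<dots> = (3 / 4 * \<epsilon>) ^ CARD('d) * L ^ CARD('d)" by (simp only: power_mult_distrib)
    also have "(3 / 4 * \<epsilon>) ^ CARD('d) \<le> (3 / 4 * \<epsilon>) ^ 1"
      using assms by (intro power_decreasing) (auto simp: Suc_le_eq)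
    also have "(3 / 4 * \<epsilon>) ^ 1 * L ^ CARD('d) < \<epsilon> * L ^ CARD('d)"
      using assms by simp
    finally show ?thesis using assms by (simp add: mult_right_mono)
  qed
  with card show ?thesis using assms by (simp add: pos_divide_less_eq)
qed

text \<open>The density bound is guarded because the origin is always activated: by
  \<open>density_bound_only_if\<close>, it cannot hold together with the inclusion for any other
  \<open>L\<close>.\<close>

theorem theorem2p5:
  fixes Q :: "int ^ 'd \<Rightarrow> (int ^ 'd) pmf" and \<alpha> lam \<epsilon> :: real and l :: nat
  assumes "symmetric_kernel Q" and "translation_invariant Q" and "heavy_tailed \<alpha> Q"
    and "\<alpha> > real CARD('d)"
    and "lam > 0" and "l \<ge> 1"
    and "0 < \<epsilon>" and "\<epsilon> < 1"
  shows "\<exists>c>0. \<P>(\<omega> in frog_model Q lam. \<forall>L>0.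
      activated l \<omega> (c * L) \<subseteq> lattice_box L \<and>
      (L ^ CARD('d) > 1 / \<epsilon> \<longrightarrow>
        real (card (activated l \<omega> (c * L))) / L ^ CARD('d) < \<epsilon>)) \<ge> 1 - \<epsilon>"
proof -
  let ?M = "frog_model Q lam"
  interpret prob_space ?M by (rule prob_space_frog_model)
  obtain \<beta> where \<beta>: "1 < \<beta>" and small: "\<And>e. 0 < e \<Longrightarrow> \<forall>\<^sub>F k0 in sequentially.
    emeasure ?M (\<Union>i n. dense_chain l (2 ^ (k0 + i)) (2 powr - (\<beta> * real (k0 + i))) (Suc n)) \<le> ennreal e"
    using dense_chain_union_small[OF assms(3-6)] by blast
  define s where "s k i = 2 powr - (\<beta> * real (k + i))" for k i :: nat
  define U where "U k = (\<Union>i n. dense_chain l (2 ^ (k + i)) (s k i) (Suc n) :: (int ^ 'd) config set)" for k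
  define Z where "Z = (\<Union>(v :: int ^ 'd, j). {\<omega> :: (int ^ 'd) config. j < fst \<omega> v \<and> snd \<omega> (v, j) 0 \<noteq> v})"
  \<comment> \<open>One scale \<open>k\<close> has to serve both the probability bound and the
    series bound; each holds for all large \<open>k\<close>.\<close>
  have "\<forall>\<^sub>F k in sequentially. emeasure ?M (U k) \<le> ennreal \<epsilon> \<and> (\<forall>n. (\<Sum>i<n. 2 ^ (k + i + 1) * s k i) \<le> 1 / 2)"
    unfolding U_def s_def by (intro eventually_conj small growth_series_small \<beta> assms(7))
  then obtain k where U: "emeasure ?M (U k) \<le> ennreal \<epsilon>" and sum: "\<And>n. (\<Sum>i<n. 2 ^ (k + i + 1) * s k i) \<le> 1 / 2"
    by (auto simp: eventually_sequentially)
  \<comment> \<open>Paths advance at most \<open>2 ^ (k + 1)\<close> per unit of time, so time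
    \<open>c * L\<close> confines them to radius \<open>\<epsilon> / 4 * L\<close>, small enough for
    the density bound.\<close>
  define c where "c = \<epsilon> / 4 / 2 ^ (k + 1)"
  have c: "0 < c" using assms by (simp add: c_def)
  let ?R = "\<lambda>S L. S \<subseteq> lattice_box L \<and> (L ^ CARD('d) > 1 / \<epsilon> \<longrightarrow> real (card S) / L ^ CARD('d) < \<epsilon>)"
  let ?E = "{\<omega>. \<forall>L>0. ?R (activated l \<omega> (c * L)) L}"
  have E_sets: "?E \<in> sets ?M"
    using c by (rule sets_activated_event) (use finite_subset[OF _ finite_lattice_box] in blast)
  have Z: "Z \<in> null_sets ?M" unfolding Z_def by (rule emeasure_frog_start)
  have UZ_sets: "U k \<union> Z \<in> sets ?M" using Z unfolding U_def by (auto intro!: sets_dense_chain)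
  \<comment> \<open>The good event does not depend on \<open>L\<close>, so all \<open>L\<close> are
    handled at once.\<close>
  have "- (U k \<union> Z) \<subseteq> ?E"
  proof (intro subsetI CollectI allI impI)
    fix \<omega> :: "(int ^ 'd) config" and L :: real
    assume \<omega>: "\<omega> \<in> - (U k \<union> Z)" and L: "0 < L"
    have sub: "activated l \<omega> (c * L) \<subseteq> {u. vnorm u \<le> \<epsilon> / 4 * L}"
    proof
      fix u assume u: "u \<in> activated l \<omega> (c * L)"
      have start: "snd \<omega> (v, j) 0 = v" if "j < fst \<omega> v" for v j
        using \<omega> that by (auto simp: Z_def)
      obtain m p where p: "p 0 = 0" "p m = u" "inj_on p {..<m}" "real m \<le> c * L"
        "\<And>i. i < m \<Longrightarrow> \<exists>j<fst \<omega> (p i). \<exists>n\<le>l. snd \<omega> (p i, j) n = p (Suc i)"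
        using activated_obtain_path[OF u start] by blast
      have "vnorm (p m) \<le> 2 ^ (k + 1) * real m"
        by (rule path_reach_le[OF _ _ sum p(1,3,5)]) (use \<omega> in \<open>auto simp: U_def s_def\<close>)
      also have "\<dots> \<le> 2 ^ (k + 1) * (c * L)" using p(4) by (intro mult_left_mono) auto
      also have "\<dots> = \<epsilon> / 4 * L" by (simp add: c_def)
      finally show "u \<in> {u. vnorm u \<le> \<epsilon> / 4 * L}" using p by simp
    qed
    have "\<epsilon> / 4 * L \<le> L" using assms L by simp
    with sub have "activated l \<omega> (c * L) \<subseteq> lattice_box L"
      unfolding vnorm_ball_eq_lattice_box[symmetric] by force
    then show "?R (activated l \<omega> (c * L)) L"
      using small_ball_density[OF assms(7,8) L sub] by blast
  qed
  then have "prob (- (U k \<union> Z)) \<le> prob ?E" using E_sets by (rule finite_measure_mono)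
  moreover have "prob (- (U k \<union> Z)) = 1 - prob (U k \<union> Z)"
    using prob_compl[OF UZ_sets] by (simp add: space_frog_model Compl_eq_Diff_UNIV)
  moreover have "prob (U k \<union> Z) \<le> \<epsilon>"
  proof -
    have "U k \<in> sets ?M" unfolding U_def by (auto intro!: sets_dense_chain)
    then have "emeasure ?M (U k \<union> Z) = emeasure ?M (U k)" using Z by (rule emeasure_Un_null_set)
    with U show ?thesis using assms(7) by (simp add: emeasure_eq_measure ennreal_le_iff)
  qed
  ultimately have "1 - \<epsilon> \<le> prob ?E" by linarith
  then show ?thesis using c by (intro exI[of _ c]) (simp add: space_frog_model)
qed

end
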